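(* Let $1\leq k\leq n-1$ and let $\sigma^{:}$ be a decorated permutation on $[n]$. Then the positroid of $\sigma^{:}$ is an elementary quotient of the uniform matroid $U_{k,n}$ if and only if $\sigma^{:}=\overrightarrow{\rho_A}(\pi_{k,n})$ for some proper subset $A\subsetneq[n]$ such that the union of any two distinct cyclic components of $A$ has cardinality at most $k-1$.
   Context: For $i\in[n]$ the cyclic order $<_i$ is $i<_i i+1<_i\cdots<_i n<_i 1<_i\cdots<_i i-1$. A decorated permutation on $[n]$ is a pair $(\pi,\operatorname{col})$, $\pi$ a permutation of $[n]$, $\operatorname{col}:[n]\to\{0,1,-1\}$ with $\operatorname{col}(i)=0$ iff $\pi(i)\ne i$. Its Grassmann necklace is $I_i=\{j: j<_i\pi^{-1}(j)\text{ or }\operatorname{col}(j)=-1\}$ and its positroid is the matroid whose bases are the sets $B$ of size $|I_1|$ such that for every $i$ and $t$ the $t$-th smallest element of $I_i$ under $<_i$ is $\leq_i$ the $t$-th smallest element of $B$. $\pi_{k,n}$ denotes the decorated permutation of $U_{k,n}$: $\pi_{k,n}(i)=i+k\pmod n$ (no fixed points). Cyclic shift: for $A\subseteq[n]$, $\overrightarrow{\rho_A}(\pi,\operatorname{col}_\pi)=(\sigma,\operatorname{col}_\sigma)$ where for $i\in A$, $\sigma(i)=\pi(i)$, $\operatorname{col}_\sigma(i)=\operatorname{col}_\pi(i)$; for $i\notin A$, $\sigma(i)=\pi(j)$ with $j$ the maximum element of $[n]\setminus A$ under $<_i$, and $\operatorname{col}_\sigma(i)=1$ if $\sigma(i)=i$,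 else $0$. Every proper subset $A\subsetneq[n]$ decomposes uniquely as a disjoint union of cyclic intervals $[a_1,b_1]\sqcup\cdots\sqcup[a_s,b_s]$ (cyclic interval $[a,b]=\{a,a+1,\dots,b\}$ mod $n$) such that no $b_j+1\equiv a_i\pmod n$; these are the cyclic components of $A$. $M$ is an elementary quotient of $N$ if every circuit of $N$ is a union of circuits of $M$ and $\operatorname{rk}(M)=\operatorname{rk}(N)-1$.
   Formalization: The condition is required of any two cyclic components, equal or distinct, so a sole component must have at most k-1 elements; with only distinct ones the claim fails (n=2, k=1, A={1} gives U_{1,2} itself). *)

theory Defs
  imports "HOL-Combinatorics.Permutations" "HOL-Library.Disjoint_Sets"
begin

section \<open>Cyclic orders on \<open>{1..n}\<close>\<close>

text \<open>The order \<open>i < i+1 < \<dots> < n < 1 < \<dots> < i-1\<close>; it does not need to mention \<open>n\<close>.\<close>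

definition cyc_less :: "nat \<Rightarrow> nat \<Rightarrow> nat \<Rightarrow> bool" where
  "cyc_less i a b \<longleftrightarrow>
     (i \<le> a \<and> i \<le> b \<and> a < b) \<or> (a < i \<and> b < i \<and> a < b) \<or> (i \<le> a \<and> b < i)"

definition cyc_le :: "nat \<Rightarrow> nat \<Rightarrow> nat \<Rightarrow> bool" where
  "cyc_le i a b \<longleftrightarrow> a = b \<or> cyc_less i a b"

definition cyc_max :: "nat \<Rightarrow> nat set \<Rightarrow> nat" where
  "cyc_max i S = (THE j. j \<in> S \<and> (\<forall>x\<in>S. cyc_le i x j))"

text \<open>The \<open>t\<close>-th smallest element of \<open>S\<close>, counted from \<open>t = 1\<close>.\<close>

definition cyc_nth :: "nat \<Rightarrow> nat set \<Rightarrow> nat \<Rightarrow> nat" where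
  "cyc_nth i S t = (THE x. x \<in> S \<and> card {y \<in> S. cyc_less i y x} + 1 = t)"

section \<open>Matroids given by their bases\<close>

record 'a bases_system =
  ground :: "'a set"
  bases :: "'a set set"

definition matroid :: "'a bases_system \<Rightarrow> bool" where
  "matroid M \<longleftrightarrow>
     finite (ground M) \<and> bases M \<noteq> {} \<and> (\<forall>B\<in>bases M. B \<subseteq> ground M) \<and>
     (\<forall>B\<in>bases M. \<forall>B'\<in>bases M. \<forall>x\<in>B - B'. \<exists>y\<in>B' - B. insert y (B - {x}) \<in> bases M)"

definition indep :: "'a bases_system \<Rightarrow> 'a set \<Rightarrow> bool" where
  "indep M X \<longleftrightarrow> (\<exists>B\<in>bases M. X \<subseteq> B)"

definition circuits :: "'a bases_system \<Rightarrow> 'a set set" where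
  "circuits M = {C. C \<subseteq> ground M \<and> \<not> indep M C \<and> (\<forall>D. D \<subset> C \<longrightarrow> indep M D)}"

definition matroid_rank :: "'a bases_system \<Rightarrow> nat" where
  "matroid_rank M = Max (card ` {X. indep M X})"

text \<open>
  The rank condition \<open>rk M = rk N - 1\<close> is written additively because subtraction on
  \<^typ>\<open>nat\<close> truncates.
\<close>

definition elementary_quotient :: "'a bases_system \<Rightarrow> 'a bases_system \<Rightarrow> bool" where
  "elementary_quotient M N \<longleftrightarrow>
     matroid M \<and> matroid N \<and> ground M = ground N \<and>
     (\<forall>C\<in>circuits N. \<exists>F\<subseteq>circuits M. C = \<Union>F) \<and>
     matroid_rank M + 1 = matroid_rank N"

definition uniform_matroid :: "nat \<Rightarrow> nat \<Rightarrow> nat bases_system" where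
  "uniform_matroid k n = \<lparr>ground = {1..n}, bases = {B. B \<subseteq> {1..n} \<and> card B = k}\<rparr>"

section \<open>Decorated permutations and their positroids\<close>

text \<open>
  Outside \<open>{1..n}\<close> the permutation is the identity and the colouring is \<open>0\<close>, so that
  equality of pairs is equality of decorated permutations on \<open>{1..n}\<close>.
\<close>

type_synonym decorated_perm = "(nat \<Rightarrow> nat) \<times> (nat \<Rightarrow> int)"

definition decorated_permutation :: "nat \<Rightarrow> decorated_perm \<Rightarrow> bool" where
  "decorated_permutation n = (\<lambda>(p, col).
     p permutes {1..n} \<and>
     (\<forall>i\<in>{1..n}. col i \<in> {0, 1, -1} \<and> (col i = 0 \<longleftrightarrow> p i \<noteq> i)) \<and>
     (\<forall>i. i \<notin> {1..n} \<longrightarrow> col i = 0))"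

definition grassmann_necklace :: "nat \<Rightarrow> decorated_perm \<Rightarrow> nat \<Rightarrow> nat set" where
  "grassmann_necklace n = (\<lambda>(p, col) i. {j \<in> {1..n}. cyc_less i j (inv p j) \<or> col j = -1})"

definition positroid :: "nat \<Rightarrow> decorated_perm \<Rightarrow> nat bases_system" where
  "positroid n s =
     (let I = grassmann_necklace n s; r = card (I 1) in
      \<lparr>ground = {1..n},
       bases = {B. B \<subseteq> {1..n} \<and> card B = r \<and>
                   (\<forall>i\<in>{1..n}. \<forall>t\<in>{1..r}. cyc_le i (cyc_nth i (I i) t) (cyc_nth i B t))}\<rparr>)"

text \<open>The map \<open>i \<mapsto> i + k\<close> modulo \<open>n\<close>, with representatives in \<open>{1..n}\<close>.\<close>

definition uniform_perm :: "nat \<Rightarrow> nat \<Rightarrow> decorated_perm" where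
  "uniform_perm k n =
     (\<lambda>i. if i \<in> {1..n} then (i + k - 1) mod n + 1 else i, \<lambda>i. 0)"

definition cyclic_shift :: "nat \<Rightarrow> nat set \<Rightarrow> decorated_perm \<Rightarrow> decorated_perm" where
  "cyclic_shift n A = (\<lambda>(p, col).
     (let q = (\<lambda>i. if i \<in> {1..n} - A then p (cyc_max i ({1..n} - A)) else p i) in
      (q, \<lambda>i. if i \<in> {1..n} - A then (if q i = i then 1 else 0) else col i)))"

section \<open>Cyclic components\<close>

definition cyc_interval :: "nat \<Rightarrow> nat \<Rightarrow> nat \<Rightarrow> nat set" where
  "cyc_interval n a b = {x \<in> {1..n}. cyc_le a x b}"

text \<open>
  A decomposition is given by the set \<open>P\<close> of pairs of endpoints.  The last condition
  includes the case of a single interval, where it says that the interval is not all of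
  \<open>{1..n}\<close>.
\<close>

definition cyclic_decomposition :: "nat \<Rightarrow> nat set \<Rightarrow> (nat \<times> nat) set \<Rightarrow> bool" where
  "cyclic_decomposition n A P \<longleftrightarrow>
     P \<subseteq> {1..n} \<times> {1..n} \<and>
     A = (\<Union>(a, b)\<in>P. cyc_interval n a b) \<and>
     disjoint_family_on (\<lambda>(a, b). cyc_interval n a b) P \<and>
     (\<forall>(a, b)\<in>P. \<forall>(a', b')\<in>P. (b + 1) mod n \<noteq> a' mod n)"

definition cyclic_components :: "nat \<Rightarrow> nat set \<Rightarrow> nat set set" where
  "cyclic_components n A =
     (\<lambda>(a, b). cyc_interval n a b) ` (THE P. cyclic_decomposition n A P)"

text \<open>
  The union of any two components has at most \<open>m\<close> elements.  The two components are
  allowed to coincide, so a sole component must itself have at most \<open>m\<close> elements; with two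
  or more components this is the same as quantifying over distinct ones.  For \<open>m = k - 1\<close>
  the sole-component case cannot be dropped: if \<open>A\<close> is a single cyclic interval with at
  least \<open>k\<close> elements, then shifting the decorated permutation of \<open>U\<^bsub>k,n\<^esub>\<close> along \<open>A\<close> does not
  lower the rank.  For example, if \<open>A\<close> has \<open>n - 1\<close> elements, the shift is the identity.
\<close>

definition component_unions_bounded :: "nat \<Rightarrow> nat set \<Rightarrow> nat \<Rightarrow> bool" where
  "component_unions_bounded n A m \<longleftrightarrow>
     (\<forall>C\<in>cyclic_components n A. \<forall>D\<in>cyclic_components n A. card (C \<union> D) \<le> m)"

end

theory Submission
  imports Defs
begin

text \<open>
  A matroid \<open>M\<close> on \<open>{1..n}\<close> is an elementary quotient of \<open>U\<^bsub>k,n\<^esub>\<close> iff it has rank \<open>k - 1\<close> and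
  every \<open>k\<close>-set contains a basis.  For a positroid, applying the second condition to the cyclic
  intervals \<open>{i, \<dots>, i + k - 1}\<close> forces \<open>I\<^sub>i = {i, \<dots>, i + k - 1} - {x\<^sub>i}\<close>, and comparing \<open>I\<^sub>i\<close> with
  \<open>I\<^sub>i\<^sub>+\<^sub>1\<close> shows that the decorated permutation is the shift along
  \<open>A = {i. x\<^sub>i\<^sub>+\<^sub>1 = x\<^sub>i}\<close>, all of whose components have fewer than \<open>k\<close> elements.

  For such a shift, a \<open>(k - 1)\<close>-set is a basis iff for no component \<open>[a, b]\<close>, with \<open>c\<close> elements,
  it contains the interval of length \<open>k - c\<close> that starts at \<open>b + 1\<close>.  If two components have
  \<open>c + d \<ge> k\<close> elements together, then their intervals are disjoint and fit into a common \<open>k\<close>-set,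
  which then contains no basis.  If always \<open>c + d < k\<close>, then no \<open>k\<close>-set contains two of the
  intervals; this gives both basis exchange and a basis inside every \<open>k\<close>-set.
\<close>

section \<open>Elementary quotients of uniform matroids\<close>

lemma matroid_finite_basis: "matroid M \<Longrightarrow> B \<in> bases M \<Longrightarrow> finite B"
  unfolding matroid_def by (meson finite_subset)

lemma matroid_exchange:
  assumes "matroid M" "B \<in> bases M" "B' \<in> bases M" "x \<in> B" "x \<notin> B'"
  obtains y where "y \<in> B'" "y \<notin> B" "insert y (B - {x}) \<in> bases M"
proof -
  have "\<forall>x\<in>B - B'. \<exists>y\<in>B' - B. insert y (B - {x}) \<in> bases M"
    using assms(1-3) unfolding matroid_def by blast
  then show thesis using that assms(4,5) by blast
qed

text \<open>Each exchange keeps the size of \<open>B\<close> and shrinks \<open>B - B'\<close>, so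
  repeated exchange ends with a basis contained in \<open>B'\<close>.\<close>

lemma matroid_bases_card_le:
  assumes "matroid M" "B \<in> bases M" "B' \<in> bases M"
  shows "card B \<le> card B'"
  using assms(2)
proof (induction "card (B - B')" arbitrary: B rule: less_induct)
  case less
  note fin = matroid_finite_basis[OF assms(1)]
  show ?case
  proof (cases "B \<subseteq> B'")
    case True
    then show ?thesis using fin[OF assms(3)] card_mono by blast
  next
    case False
    then obtain x where x: "x \<in> B" "x \<notin> B'" by blast
    obtain y where y: "y \<in> B'" "y \<notin> B" "insert y (B - {x}) \<in> bases M"
      using matroid_exchange[OF assms(1) less.prems assms(3) x] .
    have "insert y (B - {x}) - B' \<subset> B - B'" using x y(1) by auto
    then have "card (insert y (B - {x}) - B') < card (B - B')"
      using fin[OF less.prems] by (simp add: psubset_card_mono)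
    from less.hyps[OF this y(3)] have "card (insert y (B - {x})) \<le> card B'" .
    moreover have "card (insert y (B - {x})) = card B"
      using y(2) card.remove[OF fin[OF less.prems] x(1)] fin[OF less.prems] by simp
    ultimately show ?thesis by simp
  qed
qed

lemma matroid_bases_card:
  "matroid M \<Longrightarrow> B \<in> bases M \<Longrightarrow> B' \<in> bases M \<Longrightarrow> card B = card B'"
  by (meson antisym matroid_bases_card_le)

lemma matroid_rank_eq:
  assumes "matroid M" "B \<in> bases M"
  shows "matroid_rank M = card B"
proof -
  have sub: "{X. indep M X} \<subseteq> Pow (ground M)"
    using assms(1) unfolding indep_def matroid_def by blast
  have "finite (ground M)" using assms(1) by (simp add: matroid_def)
  then have fin: "finite (card ` {X. indep M X})"
    using sub by (meson finite_Pow_iff finite_imageI finite_subset)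
  have "card X \<le> card B" if "indep M X" for X
    using that matroid_bases_card[OF assms(1) _ assms(2)] matroid_finite_basis[OF assms(1)]
    unfolding indep_def by (metis card_mono)
  moreover have "indep M B" using assms(2) unfolding indep_def by blast
  ultimately show ?thesis
    unfolding matroid_rank_def using fin by (intro Max_eqI) auto
qed

lemma indep_augment:
  assumes M: "matroid M" and "indep M I" "indep M J" "card I < card J"
  obtains z where "z \<in> J" "z \<notin> I" "indep M (insert z I)"
proof (rule ccontr)
  assume "\<not> thesis"
  then have no: "\<And>z. z \<in> J \<Longrightarrow> z \<notin> I \<Longrightarrow> \<not> indep M (insert z I)"
    using that by blast
  note fin = matroid_finite_basis[OF M]
  txt \<open>Bases \<open>B \<supseteq> I\<close> and \<open>B' \<supseteq> J\<close> that differ as little as possible: exchanging an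
    element outside \<open>I\<close> (or \<open>J\<close>) would bring them closer.\<close>
  define Q where "Q = (\<lambda>(B, B'). B \<in> bases M \<and> B' \<in> bases M \<and> I \<subseteq> B \<and> J \<subseteq> B')"
  obtain B0 B0' where "Q (B0, B0')"
    using assms unfolding indep_def Q_def by auto
  then obtain BB where BB: "Q BB"
    and least: "\<And>CC. Q CC \<Longrightarrow> card (fst BB - snd BB) \<le> card (fst CC - snd CC)"
    using ex_has_least_nat[of Q "(B0, B0')" "\<lambda>p. card (fst p - snd p)"] by blast
  obtain B B' where [simp]: "BB = (B, B')" by fastforce
  have B: "B \<in> bases M" "B' \<in> bases M" "I \<subseteq> B" "J \<subseteq> B'" using BB by (auto simp: Q_def)
  have min: "card (B - B') \<le> card (C - C')"
    if "C \<in> bases M" "C' \<in> bases M" "I \<subseteq> C" "J \<subseteq> C'" for C C'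
    using least[of "(C, C')"] that by (simp add: Q_def)
  have fB: "finite (B - B')" using fin[OF B(1)] by simp
  have 1: "B - B' \<subseteq> I"
  proof (rule ccontr)
    assume "\<not> ?thesis"
    then obtain x where x: "x \<in> B" "x \<notin> B'" "x \<notin> I" by blast
    obtain y where y: "y \<in> B'" "y \<notin> B" "insert y (B - {x}) \<in> bases M"
      using matroid_exchange[OF M B(1,2) x(1,2)] .
    have less: "insert y (B - {x}) - B' \<subset> B - B'" using x y(1) by auto
    have "I \<subseteq> insert y (B - {x})" using B(3) x(3) by auto
    from min[OF y(3) B(2) this B(4)] psubset_card_mono[OF fB less] show False by linarith
  qed
  have 2: "B' - B \<subseteq> J"
  proof (rule ccontr)
    assume "\<not> ?thesis"
    then obtain x where x: "x \<in> B'" "x \<notin> B" "x \<notin> J" by blast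
    obtain y where y: "y \<in> B" "y \<notin> B'" "insert y (B' - {x}) \<in> bases M"
      using matroid_exchange[OF M B(2,1) x(1,2)] .
    have less: "B - insert y (B' - {x}) \<subset> B - B'" using x(2) y by auto
    have "J \<subseteq> insert y (B' - {x})" using B(4) x(3) by auto
    from min[OF B(1) y(3) B(3) this] psubset_card_mono[OF fB less] show False by linarith
  qed
  \<comment> \<open>An element of \<open>J - I\<close> that lies in \<open>B\<close> would extend
    \<open>I\<close> within the basis \<open>B\<close>, contrary to \<open>no\<close>.\<close>
  have 3: "J - I \<subseteq> B' - B"
  proof
    fix z assume "z \<in> J - I"
    then have "z \<notin> B" using no[of z] B(1,3) unfolding indep_def by blast
    then show "z \<in> B' - B" using \<open>z \<in> J - I\<close> B(4) by blast
  qed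
  have fI: "finite I" "finite J" using B fin finite_subset by blast+
  \<comment> \<open>The differences of the bases are now tied to those of \<open>I\<close> and
    \<open>J\<close>: \<open>card (J - I) <= card (B' - B) = card (B - B') <= card (I - J)\<close>,
    against \<open>card I < card J\<close>.\<close>
  have "card (B - B') = card (B' - B)"
    using matroid_bases_card[OF M B(1,2)] fin B(1,2)
    by (intro antisym card_le_sym_Diff) auto
  moreover have "card (J - I) \<le> card (B' - B)" using 3 fin[OF B(2)] by (simp add: card_mono)
  moreover have "card (B - B') \<le> card (I - J)" using 1 B(4) fI by (intro card_mono) auto
  moreover have "card (I - J) < card (J - I)" using card_less_sym_Diff[OF fI assms(4)] .
  ultimately show False by linarith
qed

section \<open>Circuits of uniform matroids and a criterion for elementary quotients\<close>

lemma dependent_contains_circuit: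
  assumes "finite X" "X \<subseteq> ground M" "\<not> indep M X"
  shows "\<exists>C\<in>circuits M. C \<subseteq> X"
  using assms
proof (induction X rule: finite_psubset_induct)
  case (psubset X)
  show ?case
  proof (cases "\<forall>D. D \<subset> X \<longrightarrow> indep M D")
    case True
    then have "X \<in> circuits M" using psubset.prems by (simp add: circuits_def)
    then show ?thesis using psubset.prems by blast
  next
    case False
    then obtain D where D: "D \<subset> X" "\<not> indep M D" by blast
    then have "\<exists>C\<in>circuits M. C \<subseteq> D"
      using psubset.IH[OF D(1) _ D(2)] psubset.prems by blast
    then show ?thesis using D(1) by blast
  qed
qed

lemma indep_uniform:
  assumes "k \<le> n"
  shows "indep (uniform_matroid k n) X \<longleftrightarrow> X \<subseteq> {1..n} \<and> card X \<le> k"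
proof
  assume "indep (uniform_matroid k n) X"
  then show "X \<subseteq> {1..n} \<and> card X \<le> k"
    unfolding indep_def uniform_matroid_def
    by (auto intro!: card_mono finite_subset[of _ "{Suc 0..n}"])
next
  assume X: "X \<subseteq> {1..n} \<and> card X \<le> k"
  then obtain B where "X \<subseteq> B" "B \<subseteq> {1..n}" "card B = k"
    using exists_subset_between[of X k "{1..n}"] assms by auto
  then show "indep (uniform_matroid k n) X"
    unfolding indep_def uniform_matroid_def by auto
qed

lemma circuits_uniform:
  assumes "k < n"
  shows "circuits (uniform_matroid k n) = {C. C \<subseteq> {1..n} \<and> card C = k + 1}"
proof -
  have [simp]: "ground (uniform_matroid k n) = {1..n}" by (simp add: uniform_matroid_def)
  have "card C = k + 1 \<longleftrightarrow> \<not> card C \<le> k \<and> (\<forall>D. D \<subset> C \<longrightarrow> card D \<le> k)"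
    if "C \<subseteq> {1..n}" for C
  proof -
    have fC: "finite C" using that finite_subset by blast
    show ?thesis
    proof
      assume C: "card C = k + 1"
      have "card D \<le> k" if "D \<subset> C" for D using psubset_card_mono[OF fC that] C by simp
      then show "\<not> card C \<le> k \<and> (\<forall>D. D \<subset> C \<longrightarrow> card D \<le> k)" using C by simp
    next
      assume a: "\<not> card C \<le> k \<and> (\<forall>D. D \<subset> C \<longrightarrow> card D \<le> k)"
      then have "C \<noteq> {}" by auto
      then obtain x where x: "x \<in> C" by blast
      then have "C - {x} \<subset> C" by blast
      then have "card (C - {x}) \<le> k" using a by blast
      then show "card C = k + 1" using a card.remove[OF fC x] by simp
    qed
  qed
  then show ?thesis
    using assms by (auto simp: circuits_def indep_uniform)
qed

lemma matroid_uniform: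
  assumes "k \<le> n"
  shows "matroid (uniform_matroid k n)"
proof -
  have "\<exists>y\<in>B' - B. insert y (B - {x}) \<subseteq> {1..n} \<and> card (insert y (B - {x})) = k"
    if B: "B \<subseteq> {1..n}" "card B = k" "B' \<subseteq> {1..n}" "card B' = k" "x \<in> B - B'" for B B' x
  proof -
    have fin: "finite B" "finite B'" using B finite_subset by blast+
    have "\<not> B' \<subseteq> B" using B fin by (metis DiffE card_subset_eq)
    then obtain y where "y \<in> B' - B" by blast
    moreover have "0 < card B" using B fin by (auto simp: card_gt_0_iff)
    ultimately show ?thesis using B fin by (intro bexI[of _ y]) auto
  qed
  moreover obtain B where "B \<subseteq> {1..n}" "card B = k"
    using assms by (metis card_atLeastAtMost diff_Suc_1 obtain_subset_with_card_n)
  ultimately show ?thesis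
    unfolding matroid_def uniform_matroid_def by auto
qed

text \<open>The circuits of the uniform matroid are the \<open>(k + 1)\<close>-sets, and such a set
  is a union of circuits of \<open>M\<close> iff each of its elements lies on a circuit of
  \<open>M\<close> inside the set. For \<open>M\<close> of rank \<open>k - 1\<close>, this holds for
  all these sets iff every \<open>k\<close>-set spans \<open>M\<close>.\<close>

lemma elementary_quotient_uniform_iff:
  assumes k: "k < n" and ground: "ground M = {1..n}"
  shows "elementary_quotient M (uniform_matroid k n) \<longleftrightarrow>
    matroid M \<and> (\<forall>B\<in>bases M. card B + 1 = k) \<and>
    (\<forall>K. K \<subseteq> {1..n} \<and> card K = k \<longrightarrow> (\<exists>B\<in>bases M. B \<subseteq> K))"
    (is "?L \<longleftrightarrow> ?R")
proof -
  have mU: "matroid (uniform_matroid k n)" using matroid_uniform k by simp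
  have gU: "ground (uniform_matroid k n) = {1..n}" by (simp add: uniform_matroid_def)
  have rU: "matroid_rank (uniform_matroid k n) = k"
  proof -
    obtain B where "B \<in> bases (uniform_matroid k n)" using mU unfolding matroid_def by blast
    then show ?thesis using matroid_rank_eq[OF mU] by (simp add: uniform_matroid_def)
  qed
  show ?thesis
  proof
    assume L: ?L
    then have M: "matroid M" and rk: "matroid_rank M + 1 = k" unfolding elementary_quotient_def rU by auto
    have circ: "\<exists>F\<subseteq>circuits M. C = \<Union>F" if "C \<subseteq> {1..n}" "card C = k + 1" for C
      using L that unfolding elementary_quotient_def circuits_uniform[OF k] by auto
    have card_basis: "card B + 1 = k" if "B \<in> bases M" for B
      using matroid_rank_eq[OF M that] rk by simp
    have "\<exists>B\<in>bases M. B \<subseteq> K" if K: "K \<subseteq> {1..n}" "card K = k" for K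
    proof (rule ccontr)
      assume no: "\<not> ?thesis"
      have fK: "finite K" using K finite_subset by blast
      have max_ext: "\<exists>J. I \<subseteq> J \<and> J \<subseteq> K \<and> indep M J \<and> (\<forall>z\<in>K - J. \<not> indep M (insert z J))"
        if "I \<subseteq> K" "indep M I" for I
      proof -
        have "finite {J. I \<subseteq> J \<and> J \<subseteq> K \<and> indep M J}"
          using fK by (intro finite_subset[OF _ finite_Pow_iff[THEN iffD2, OF fK]]) auto
        moreover have "I \<in> {J. I \<subseteq> J \<and> J \<subseteq> K \<and> indep M J}" using that by simp
        ultimately obtain J where J: "J \<in> {J. I \<subseteq> J \<and> J \<subseteq> K \<and> indep M J}"
          "\<forall>J'\<in>{J. I \<subseteq> J \<and> J \<subseteq> K \<and> indep M J}. J \<subseteq> J' \<longrightarrow> J = J'"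
          using finite_has_maximal by (metis (no_types, lifting) empty_iff)
        have "\<not> indep M (insert z J)" if "z \<in> K - J" for z
          using J that by blast
        then show ?thesis using J by blast
      qed
      txt \<open>In matroid terms, \<open>y\<close> lies outside the closure of \<open>K\<close>, although a circuit through \<open>y\<close>
        is contained in \<open>insert y K\<close>.\<close>
      have "indep M {}" using M unfolding indep_def matroid_def by blast
      then obtain J where J: "J \<subseteq> K" "indep M J" "\<And>z. z \<in> K - J \<Longrightarrow> \<not> indep M (insert z J)"
        using max_ext[of "{}"] by blast
      obtain B where B: "B \<in> bases M" "J \<subseteq> B" using J unfolding indep_def by blast
      have "J \<noteq> B" using no B J by blast
      then obtain y where y: "y \<in> B" "y \<notin> J" using B by blast
      have Jy: "indep M (insert y J)" using B y unfolding indep_def by blast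
      then have yK: "y \<notin> K" using J(3) y by blast
      have "y \<in> {1..n}" using M B y ground unfolding matroid_def by blast
      then obtain F where F: "F \<subseteq> circuits M" "insert y K = \<Union>F"
        using circ[of "insert y K"] K yK fK by auto
      then obtain D where D: "D \<in> circuits M" "y \<in> D" "D \<subseteq> insert y K" by blast
      then have "indep M (D - {y})" "D - {y} \<subseteq> K" unfolding circuits_def by blast+
      then obtain J' where J': "D - {y} \<subseteq> J'" "J' \<subseteq> K" "indep M J'"
        "\<And>z. z \<in> K - J' \<Longrightarrow> \<not> indep M (insert z J')"
        using max_ext[of "D - {y}"] by blast
      \<comment> \<open>Two maximal independent subsets of \<open>K\<close> have the same size; this
        is the half needed here.\<close>
      have "card J' \<le> card J"
      proof (rule ccontr)
        assume "\<not> ?thesis"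
        then obtain z where "z \<in> J'" "z \<notin> J" "indep M (insert z J)"
          using indep_augment[OF M J(2) J'(3)] by (metis not_le)
        then show False using J(3) J'(2) by blast
      qed
      moreover have "card (insert y J) = Suc (card J)"
        using y fK J(1) finite_subset by (metis card_insert_disjoint)
      \<comment> \<open>As \<open>insert y J\<close> is larger than \<open>J'\<close>, some
        \<open>z\<close> in it augments \<open>J'\<close>. But \<open>z = y\<close> would make the
        circuit \<open>D\<close> independent, and \<open>z\<close> in \<open>K\<close> contradicts
        the maximality of \<open>J'\<close>.\<close>
      ultimately obtain z where z: "z \<in> insert y J" "z \<notin> J'" "indep M (insert z J')"
        using indep_augment[OF M J'(3) Jy] by (metis le_imp_less_Suc)
      show False
      proof (cases "z = y")
        case True
        then have "D \<subseteq> insert z J'" using J'(1) by blast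
        then have "indep M D" using z(3) unfolding indep_def by blast
        then show False using D(1) by (simp add: circuits_def)
      next
        case False
        then show False using z J(1) J'(4) by blast
      qed
    qed
    then show ?R using M card_basis by blast
  next
    assume R: ?R
    then have M: "matroid M" by blast
    obtain B0 where "B0 \<in> bases M" using M unfolding matroid_def by blast
    then have rk: "matroid_rank M + 1 = k" using matroid_rank_eq[OF M] R by simp
    have "\<exists>F\<subseteq>circuits M. C = \<Union>F" if C: "C \<subseteq> {1..n}" "card C = k + 1" for C
    proof -
      have fC: "finite C" using C finite_subset by blast
      have "\<exists>D\<in>circuits M. D \<subseteq> C \<and> x \<in> D" if x: "x \<in> C" for x
      proof -
        \<comment> \<open>The circuit through \<open>x\<close> is the fundamental one: adding
          \<open>x\<close> to a basis inside \<open>C - {x}\<close> creates a dependent set, and a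
          circuit in it cannot avoid \<open>x\<close>.\<close>
        have "card (C - {x}) = k" using C x fC by simp
        then obtain B where B: "B \<in> bases M" "B \<subseteq> C - {x}" using R C by blast
        have "card (insert x B) = k"
          using B R matroid_finite_basis[OF M] by (subst card_insert_disjoint) auto
        then have "\<not> indep M (insert x B)"
          unfolding indep_def using R matroid_finite_basis[OF M]
          by (metis card_mono not_add_less1 not_less_eq_eq plus_1_eq_Suc add.commute le_refl)
        moreover have "insert x B \<subseteq> C" using B x by blast
        ultimately obtain D where D: "D \<in> circuits M" "D \<subseteq> insert x B"
          using dependent_contains_circuit[of "insert x B" M] finite_subset[OF _ fC] C(1)
          unfolding ground by (metis subset_trans)
        have "x \<in> D"
        proof (rule ccontr)
          assume "x \<notin> D"
          then have "indep M D" using D B unfolding indep_def by blast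
          then show False using D by (simp add: circuits_def)
        qed
        then show ?thesis using D \<open>insert x B \<subseteq> C\<close> by blast
      qed
      then show ?thesis
        by (intro exI[of _ "{D \<in> circuits M. D \<subseteq> C}"]) blast
    qed
    then show ?L
      unfolding elementary_quotient_def circuits_uniform[OF k] gU rU
      using M mU ground rk by auto
  qed
qed

text \<open>Everything rests on \<open>sep\<close>: a \<open>k\<close>-set contains at most one
  forbidden set. Removing a suitable element from a \<open>k\<close>-set therefore leaves a basis,
  and a failure of the exchange axiom would squeeze two forbidden sets into one
  \<open>k\<close>-set.\<close>

lemma forbidden_family_matroid:
  assumes k: "1 \<le> k" "k < n" and ground: "ground M = {1..n}"
    and bases: "bases M = {B. B \<subseteq> {1..n} \<and> card B = k - 1 \<and> (\<forall>S\<in>\<S>. \<not> S \<subseteq> B)}"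
    and ne: "{} \<notin> \<S>"
    and sep: "\<And>S S' K. S \<in> \<S> \<Longrightarrow> S' \<in> \<S> \<Longrightarrow> S \<noteq> S' \<Longrightarrow> S \<subseteq> K \<Longrightarrow> S' \<subseteq> K \<Longrightarrow> K \<subseteq> {1..n} \<Longrightarrow>
      card K \<noteq> k"
  shows "matroid M \<and> (\<forall>K. K \<subseteq> {1..n} \<and> card K = k \<longrightarrow> (\<exists>B\<in>bases M. B \<subseteq> K))"
proof -
  have contains: "\<exists>B\<in>bases M. B \<subseteq> K" if K: "K \<subseteq> {1..n}" "card K = k" for K
  proof -
    have fK: "finite K" using K finite_subset by blast
    \<comment> \<open>If a forbidden set fits into \<open>K\<close>, it is the only one and any of
      its elements will do; otherwise any element of \<open>K\<close> does.\<close>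
    obtain x where x: "x \<in> K" "\<And>S. S \<in> \<S> \<Longrightarrow> S \<subseteq> K \<Longrightarrow> x \<in> S"
    proof (cases "\<exists>S\<in>\<S>. S \<subseteq> K")
      case True
      then obtain S where S: "S \<in> \<S>" "S \<subseteq> K" by blast
      then obtain x where "x \<in> S" using ne by (metis all_not_in_conv)
      then show thesis using that S sep[OF S(1) _ _ S(2)] K by blast
    next
      case False
      obtain x where "x \<in> K" using K k by fastforce
      then show thesis using that False by blast
    qed
    have "K - {x} \<in> bases M" unfolding bases using x K fK by auto
    then show ?thesis by blast
  qed
  have "\<exists>y\<in>B' - B. insert y (B - {x}) \<in> bases M"
    if B: "B \<in> bases M" "B' \<in> bases M" "x \<in> B - B'" for B B' x
  proof (rule ccontr)
    assume "\<not> ?thesis"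
    then have no: "\<And>y. y \<in> B' - B \<Longrightarrow> insert y (B - {x}) \<notin> bases M" by blast
    have BB: "B \<subseteq> {1..n}" "B' \<subseteq> {1..n}" "card B = k - 1" "card B' = k - 1" using B bases by auto
    have fin: "finite B" "finite B'" using BB finite_subset by blast+
    have pos: "0 < card B" using B fin by (auto simp: card_gt_0_iff)
    have S: "\<exists>S\<in>\<S>. S \<subseteq> insert y (B - {x}) \<and> y \<in> S" if y: "y \<in> B' - B" for y
    proof -
      have "card (insert y (B - {x})) = k - 1" using y B BB fin pos by simp
      moreover have "insert y (B - {x}) \<subseteq> {1..n}" using y BB by blast
      ultimately obtain S where "S \<in> \<S>" "S \<subseteq> insert y (B - {x})" using no[OF y] bases by blast
      moreover have "\<not> S \<subseteq> B" using \<open>S \<in> \<S>\<close> B bases by blast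
      ultimately show ?thesis by blast
    qed
    have "\<not> B' \<subseteq> B" using B BB fin by (metis DiffE card_subset_eq)
    then obtain y where y: "y \<in> B' - B" by blast
    \<comment> \<open>If \<open>y\<close> were the only element of \<open>B' - B\<close>, the
      exchange would yield \<open>B'\<close> itself, which is a basis. So there is a second element
      \<open>y'\<close>, and the forbidden sets through \<open>y\<close> and \<open>y'\<close> both
      lie in the \<open>k\<close>-set \<open>?K\<close>.\<close>
    have "insert y (B - {x}) \<noteq> B'" using no[OF y] B by blast
    moreover have "card (insert y (B - {x})) = card B'" using y B BB fin pos by simp
    ultimately have "\<not> B' \<subseteq> insert y (B - {x})" using fin by (metis card_subset_eq finite.insertI finite_Diff)
    then obtain y' where y': "y' \<in> B' - B" "y' \<noteq> y" using B by blast
    obtain S where SS: "S \<in> \<S>" "S \<subseteq> insert y (B - {x})" "y \<in> S" using S[OF y] by blast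
    obtain S' where SS': "S' \<in> \<S>" "S' \<subseteq> insert y' (B - {x})" "y' \<in> S'" using S[OF y'(1)] by blast
    let ?K = "insert y' (insert y (B - {x}))"
    have "card ?K = k" using y y' B BB fin pos k by simp
    moreover have "?K \<subseteq> {1..n}" using y y' BB by blast
    moreover have "S \<noteq> S'" using SS SS' y y' by blast
    ultimately show False using sep[of S S' ?K] SS SS' by blast
  qed
  moreover have "bases M \<noteq> {}"
  proof -
    obtain K where "K \<subseteq> {1..n}" "card K = k"
      using k by (metis card_atLeastAtMost diff_Suc_1 less_imp_le obtain_subset_with_card_n)
    then show ?thesis using contains by blast
  qed
  ultimately have "matroid M" unfolding matroid_def using ground bases by simp
  then show ?thesis using contains by blast
qed

section \<open>Cyclic arithmetic and the Gale order\<close>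

text \<open>
  Case distinctions instead of \<open>mod\<close> keep these functions within linear arithmetic; they are
  meaningful for \<open>i, x \<in> {1..n}\<close> and \<open>d < n\<close>.  Counting \<open>backward\<close> starts at the predecessor:
  \<open>backward n i d\<close> is \<open>i - 1 - d\<close> modulo \<open>n\<close>.
\<close>

definition offset :: "nat \<Rightarrow> nat \<Rightarrow> nat \<Rightarrow> nat" where
  "offset n i x = (if i \<le> x then x - i else x + n - i)"

definition forward :: "nat \<Rightarrow> nat \<Rightarrow> nat \<Rightarrow> nat" where
  "forward n i d = (if i + d \<le> n then i + d else i + d - n)"

definition backward :: "nat \<Rightarrow> nat \<Rightarrow> nat \<Rightarrow> nat" where
  "backward n i d = (if d + 2 \<le> i then i - 1 - d else i + n - 1 - d)"

text \<open>The initial segments of the order \<open>cyc_less i\<close>. Comparisons in the Gale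
  order become counts of elements in them.\<close>

definition arc :: "nat \<Rightarrow> nat \<Rightarrow> nat \<Rightarrow> nat set" where
  "arc n i m = {x \<in> {1..n}. offset n i x < m}"

lemma offset_less: "i \<in> {1..n} \<Longrightarrow> x \<in> {1..n} \<Longrightarrow> offset n i x < n"
  by (auto simp: offset_def)

lemma offset_inj:
  "i \<in> {1..n} \<Longrightarrow> x \<in> {1..n} \<Longrightarrow> y \<in> {1..n} \<Longrightarrow> offset n i x = offset n i y \<Longrightarrow> x = y"
  by (auto simp: offset_def split: if_splits)

lemma offset_self [simp]: "offset n i i = 0"
  by (simp add: offset_def)

lemma forward_mem: "i \<in> {1..n} \<Longrightarrow> d < n \<Longrightarrow> forward n i d \<in> {1..n}"
  by (auto simp: forward_def)

lemma offset_forward: "i \<in> {1..n} \<Longrightarrow> d < n \<Longrightarrow> offset n i (forward n i d) = d"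
  by (auto simp: forward_def offset_def)

lemma forward_offset: "i \<in> {1..n} \<Longrightarrow> x \<in> {1..n} \<Longrightarrow> forward n i (offset n i x) = x"
  by (auto simp: forward_def offset_def)

lemma backward_mem: "i \<in> {1..n} \<Longrightarrow> d < n \<Longrightarrow> backward n i d \<in> {1..n}"
  by (auto simp: backward_def)

lemma offset_backward: "i \<in> {1..n} \<Longrightarrow> d < n \<Longrightarrow> offset n i (backward n i d) = n - 1 - d"
  by (auto simp: backward_def offset_def)

lemma cyc_less_iff:
  "i \<in> {1..n} \<Longrightarrow> a \<in> {1..n} \<Longrightarrow> b \<in> {1..n} \<Longrightarrow> cyc_less i a b \<longleftrightarrow> offset n i a < offset n i b"
  unfolding cyc_less_def offset_def by (simp split: if_split) linarith

lemma cyc_le_iff: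
  "i \<in> {1..n} \<Longrightarrow> a \<in> {1..n} \<Longrightarrow> b \<in> {1..n} \<Longrightarrow> cyc_le i a b \<longleftrightarrow> offset n i a \<le> offset n i b"
  using cyc_less_iff[of i n a b] offset_inj[of i n a b] unfolding cyc_le_def by (metis order_le_less)

lemma arc_subset: "arc n i m \<subseteq> {1..n}"
  by (auto simp: arc_def)

lemma finite_arc [simp]: "finite (arc n i m)"
  by (rule finite_subset[OF arc_subset]) simp

lemma card_arc:
  assumes "i \<in> {1..n}" "m \<le> n"
  shows "card (arc n i m) = m"
proof -
  have "arc n i m = forward n i ` {..<m}"
  proof
    show "arc n i m \<subseteq> forward n i ` {..<m}"
      using assms forward_offset by (force simp: arc_def)
    show "forward n i ` {..<m} \<subseteq> arc n i m"
      using assms forward_mem offset_forward by (force simp: arc_def)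
  qed
  moreover have "inj_on (forward n i) {..<m}"
    using assms offset_forward by (intro inj_on_inverseI[of _ "offset n i"]) auto
  ultimately show ?thesis by (simp add: card_image)
qed

text \<open>Counting smaller elements is injective on \<open>S\<close> with values below
  \<open>card S\<close>, hence onto. This makes the definite description in \<open>cyc_nth\<close>
  well defined.\<close>

lemma rank_unique:
  fixes f :: "'a \<Rightarrow> nat"
  assumes "finite S" "inj_on f S" "t < card S"
  shows "\<exists>!x. x \<in> S \<and> card {y \<in> S. f y < f x} = t"
proof -
  define g where "g = (\<lambda>x. card {y \<in> S. f y < f x})"
  have less: "g x < g y" if "x \<in> S" "y \<in> S" "f x < f y" for x y
    unfolding g_def using that assms(1) by (intro psubset_card_mono) auto
  have inj: "inj_on g S"
  proof (rule inj_onI)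
    fix x y assume a: "x \<in> S" "y \<in> S" "g x = g y"
    then have "f x = f y" using less[of x y] less[of y x] by (cases "f x" "f y" rule: linorder_cases) auto
    then show "x = y" using a assms(2) by (simp add: inj_on_eq_iff)
  qed
  have "g x < card S" if "x \<in> S" for x
    unfolding g_def using that assms(1) by (intro psubset_card_mono) auto
  then have "g ` S \<subseteq> {..<card S}" by auto
  then have "g ` S = {..<card S}"
    using inj by (intro card_subset_eq) (auto simp: card_image)
  then obtain x where x: "x \<in> S" "g x = t" using assms(3) by (metis imageE lessThan_iff)
  have "\<exists>!x. x \<in> S \<and> g x = t"
    using x by (intro ex1I[of _ x]) (auto intro: inj_onD[OF inj])
  then show ?thesis by (simp only: g_def)
qed

text \<open>Trades positions for counts: the arguments about the Gale order need no other access to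
  \<open>cyc_nth\<close>.\<close>

lemma cyc_nth_less_iff:
  assumes i: "i \<in> {1..n}" and S: "S \<subseteq> {1..n}" and t: "t \<in> {1..card S}"
  shows "cyc_nth i S t \<in> S" and "offset n i (cyc_nth i S t) < m \<longleftrightarrow> t \<le> card (S \<inter> arc n i m)"
proof -
  have fS: "finite S" using S finite_subset by blast
  have inj: "inj_on (offset n i) S" using offset_inj[OF i] S by (meson inj_onI subsetD)
  have eq: "x \<in> S \<and> card {y \<in> S. cyc_less i y x} + 1 = t \<longleftrightarrow>
      x \<in> S \<and> card {y \<in> S. offset n i y < offset n i x} = t - 1" for x
  proof -
    have "{y \<in> S. cyc_less i y x} = {y \<in> S. offset n i y < offset n i x}" if "x \<in> S"
      using S cyc_less_iff[OF i, of _ x] that by (intro Collect_cong) (auto simp only: subset_iff)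
    \<comment> \<open>Positions start at 1, so \<open>t - 1\<close> does not truncate.\<close>
    moreover have "c + 1 = t \<longleftrightarrow> c = t - 1" for c using t by (simp add: le_diff_conv2) linarith
    ultimately show ?thesis by (simp cong: conj_cong)
  qed
  have "\<exists>!x. x \<in> S \<and> card {y \<in> S. offset n i y < offset n i x} = t - 1"
    by (rule rank_unique[OF fS inj]) (use t in auto)
  then have "\<exists>!x. x \<in> S \<and> card {y \<in> S. cyc_less i y x} + 1 = t" unfolding eq .
  from theI'[OF this, folded cyc_nth_def, unfolded eq]
  have x: "cyc_nth i S t \<in> S" "card {y \<in> S. offset n i y < offset n i (cyc_nth i S t)} = t - 1"
    by simp_all
  show "cyc_nth i S t \<in> S" by (rule x)
  let ?x = "cyc_nth i S t" and ?L = "{y \<in> S. offset n i y < offset n i (cyc_nth i S t)}"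
  have "t \<le> card (S \<inter> arc n i m)" if "offset n i ?x < m"
  proof -
    have "insert ?x ?L \<subseteq> S \<inter> arc n i m" using that x(1) S by (auto simp: arc_def)
    then have "card (insert ?x ?L) \<le> card (S \<inter> arc n i m)" using fS by (intro card_mono) auto
    then show ?thesis using x(2) fS t by simp
  qed
  moreover have "card (S \<inter> arc n i m) < t" if "\<not> offset n i ?x < m"
  proof -
    have "S \<inter> arc n i m \<subseteq> ?L" using that by (auto simp: arc_def)
    then have "card (S \<inter> arc n i m) \<le> card ?L" using fS by (intro card_mono) auto
    moreover have "1 \<le> t" using t by simp
    ultimately show ?thesis using x(2) by linarith
  qed
  ultimately show "offset n i ?x < m \<longleftrightarrow> t \<le> card (S \<inter> arc n i m)" by (meson leD)
qed

text \<open>Given \<open>m\<close>, take for \<open>t\<close> the number of elements of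
  \<open>B\<close> in the segment of length \<open>m\<close>; given \<open>t\<close>, take the
  segment that ends with the \<open>t\<close>-th element of \<open>B\<close>.\<close>

lemma gale_iff:
  assumes i: "i \<in> {1..n}" and I: "I \<subseteq> {1..n}" "card I = r" and B: "B \<subseteq> {1..n}" "card B = r"
  shows "(\<forall>t\<in>{1..r}. cyc_le i (cyc_nth i I t) (cyc_nth i B t)) \<longleftrightarrow>
    (\<forall>m. card (B \<inter> arc n i m) \<le> card (I \<inter> arc n i m))"
proof -
  have nI: "cyc_nth i I t \<in> {1..n}" "offset n i (cyc_nth i I t) < m \<longleftrightarrow> t \<le> card (I \<inter> arc n i m)"
    if "t \<in> {1..r}" for t m
    using cyc_nth_less_iff[OF i I(1), unfolded I(2), OF that] I(1) by (auto simp only: subset_iff)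
  have nB: "cyc_nth i B t \<in> {1..n}" "offset n i (cyc_nth i B t) < m \<longleftrightarrow> t \<le> card (B \<inter> arc n i m)"
    if "t \<in> {1..r}" for t m
    using cyc_nth_less_iff[OF i B(1), unfolded B(2), OF that] B(1) by (auto simp only: subset_iff)
  have le: "cyc_le i (cyc_nth i I t) (cyc_nth i B t) \<longleftrightarrow>
      offset n i (cyc_nth i I t) \<le> offset n i (cyc_nth i B t)" if "t \<in> {1..r}" for t
    by (rule cyc_le_iff[OF i nI(1)[OF that] nB(1)[OF that]])
  show ?thesis
  proof (intro iffI allI ballI)
    fix m assume a: "\<forall>t\<in>{1..r}. cyc_le i (cyc_nth i I t) (cyc_nth i B t)"
    let ?t = "card (B \<inter> arc n i m)"
    show "?t \<le> card (I \<inter> arc n i m)"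
    proof (cases "?t = 0")
      case False
      have "?t \<le> r" using B finite_subset by (metis Int_lower1 card_mono finite_atLeastAtMost)
      then have t: "?t \<in> {1..r}" using False by (simp only: atLeastAtMost_iff One_nat_def Suc_le_eq neq0_conv)
      have "offset n i (cyc_nth i B ?t) < m" using nB(2)[OF t, of m] by simp
      moreover have "offset n i (cyc_nth i I ?t) \<le> offset n i (cyc_nth i B ?t)"
        using a t le[OF t] by blast
      ultimately show ?thesis using nI(2)[OF t, of m] by simp
    qed simp
  next
    fix t assume t: "t \<in> {1..r}" and a: "\<forall>m. card (B \<inter> arc n i m) \<le> card (I \<inter> arc n i m)"
    let ?m = "Suc (offset n i (cyc_nth i B t))"
    have "t \<le> card (B \<inter> arc n i ?m)" using nB(2)[OF t, of ?m] by simp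
    then have "t \<le> card (I \<inter> arc n i ?m)" using a le_trans by blast
    then have "offset n i (cyc_nth i I t) < ?m" using nI(2)[OF t, of ?m] by simp
    then show "cyc_le i (cyc_nth i I t) (cyc_nth i B t)" using le[OF t] by simp
  qed
qed

text \<open>Before \<open>z\<close>, the set \<open>arc n i k - {z}\<close> fills every segment;
  from \<open>z\<close> on it lacks just one point, until its count reaches \<open>k - 1\<close>,
  the size of \<open>B\<close>. So a comparison fails only if \<open>B\<close> fills a segment
  containing \<open>z\<close>, and the shortest such segment ends at \<open>z\<close>.\<close>

lemma gale_arc_minus:
  assumes i: "i \<in> {1..n}" and k: "k \<le> n" and z: "z \<in> {1..n}" "offset n i z < k"
    and B: "B \<subseteq> {1..n}" "card B = k - 1"
  shows "(\<forall>m. card (B \<inter> arc n i m) \<le> card ((arc n i k - {z}) \<inter> arc n i m)) \<longleftrightarrow>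
    \<not> arc n i (offset n i z + 1) \<subseteq> B"
proof -
  let ?e = "offset n i z"
  have fB: "finite B" using B finite_subset by blast
  have below: "card ((arc n i k - {z}) \<inter> arc n i m) = m" if "m \<le> ?e" for m
  proof -
    have "(arc n i k - {z}) \<inter> arc n i m = arc n i m" using that z by (auto simp: arc_def)
    then show ?thesis using card_arc[OF i] that z k by simp
  qed
  have above: "card ((arc n i k - {z}) \<inter> arc n i m) = min m k - 1" if "?e < m" for m
  proof -
    have "(arc n i k - {z}) \<inter> arc n i m = arc n i (min m k) - {z}" by (auto simp: arc_def)
    moreover have "z \<in> arc n i (min m k)" using that z by (auto simp: arc_def)
    ultimately show ?thesis using card_arc[OF i, of "min m k"] k by simp
  qed
  have upper: "card (B \<inter> arc n i m) \<le> k - 1" for m using B fB by (metis Int_lower1 card_mono)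
  show ?thesis
  proof
    assume a: "\<forall>m. card (B \<inter> arc n i m) \<le> card ((arc n i k - {z}) \<inter> arc n i m)"
    show "\<not> arc n i (?e + 1) \<subseteq> B"
    proof
      assume "arc n i (?e + 1) \<subseteq> B"
      then have "card (B \<inter> arc n i (?e + 1)) = ?e + 1"
        using card_arc[OF i, of "?e + 1"] z k by (simp add: inf_absorb2)
      then show False using a[THEN spec, of "?e + 1"] above[of "?e + 1"] z by simp
    qed
  next
    assume a: "\<not> arc n i (?e + 1) \<subseteq> B"
    show "\<forall>m. card (B \<inter> arc n i m) \<le> card ((arc n i k - {z}) \<inter> arc n i m)"
    proof
      fix m
      consider "m \<le> ?e" | "?e < m" "m \<le> k" | "k < m" using z by linarith
      then show "card (B \<inter> arc n i m) \<le> card ((arc n i k - {z}) \<inter> arc n i m)"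
      proof cases
        case 1
        have "card (B \<inter> arc n i m) \<le> card (arc n i m)" by (intro card_mono) auto
        then show ?thesis using below[OF 1] card_arc[OF i, of m] 1 z k by simp
      next
        case 2
        have "arc n i (?e + 1) \<subseteq> arc n i m" using 2 by (auto simp: arc_def)
        then have "B \<inter> arc n i m \<subset> arc n i m" using a by blast
        then have "card (B \<inter> arc n i m) < card (arc n i m)" by (intro psubset_card_mono) auto
        then show ?thesis using above[OF 2(1)] card_arc[OF i, of m] 2 k by simp
      next
        case 3
        then show ?thesis using above[of m] upper[of m] z by simp
      qed
    qed
  qed
qed

lemma bases_positroid_arc_minus:
  assumes k: "k \<le> n" and n: "1 \<le> n"
    and z: "\<And>i. i \<in> {1..n} \<Longrightarrow> z i \<in> {1..n} \<and> offset n i (z i) < k"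
    and I: "\<And>i. i \<in> {1..n} \<Longrightarrow> grassmann_necklace n s i = arc n i k - {z i}"
  shows "bases (positroid n s) = {B. B \<subseteq> {1..n} \<and> card B = k - 1 \<and>
    (\<forall>i\<in>{1..n}. \<not> arc n i (offset n i (z i) + 1) \<subseteq> B)}"
proof -
  have sub: "arc n i k - {z i} \<subseteq> {1..n}" for i using arc_subset by blast
  have card: "card (arc n i k - {z i}) = k - 1" if "i \<in> {1..n}" for i
  proof -
    have "z i \<in> arc n i k" using z[OF that] by (simp add: arc_def)
    then show ?thesis using card_arc[OF that k] by simp
  qed
  have r: "card (grassmann_necklace n s 1) = k - 1" using I[of 1] card[of 1] n by simp
  have "(\<forall>t\<in>{1..k - 1}. cyc_le i (cyc_nth i (grassmann_necklace n s i) t) (cyc_nth i B t)) \<longleftrightarrow>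
      \<not> arc n i (offset n i (z i) + 1) \<subseteq> B"
    if "i \<in> {1..n}" "B \<subseteq> {1..n}" "card B = k - 1" for i B
    unfolding I[OF that(1)] gale_iff[OF that(1) sub card[OF that(1)] that(2,3)]
    by (rule gale_arc_minus[OF that(1) k _ _ that(2,3)]) (use z[OF that(1)] in simp_all)
  then show ?thesis
    unfolding positroid_def Let_def r by (simp cong: conj_cong)
qed

section \<open>Intersections and unions of two arcs\<close>

lemma disjoint_arcs:
  assumes i: "i \<in> {1..n}" and i': "i' \<in> {1..n}"
    and l: "l \<le> offset n i i'" and l': "l' + offset n i i' \<le> n"
  shows "arc n i l \<inter> arc n i' l' = {}"
  using assms by (auto simp: arc_def offset_def split: if_splits)

text \<open>Meant for \<open>c\<close> and \<open>d\<close> the lengths of the runs just before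
  \<open>i\<close> and \<open>i'\<close>. Whichever way the arcs overlap, their union has more than
  \<open>k\<close> points: overlap can only occur where an arc crosses the run before the other
  starting point.\<close>

lemma card_union_arcs:
  assumes i: "i \<in> {1..n}" and i': "i' \<in> {1..n}" and k: "k < n"
    and d: "d < offset n i i'" and c: "c + offset n i i' < n" and cd: "c + d < k"
  shows "k < card (arc n i (k - c) \<union> arc n i' (k - d))"
proof -
  let ?p = "offset n i i'"
  \<comment> \<open>Change of base point, so that both arcs are measured from
    \<open>i\<close>.\<close>
  have off': "offset n i' x = (if ?p \<le> offset n i x then offset n i x - ?p else offset n i x + n - ?p)"
    if "x \<in> {1..n}" for x
    using that i i' by (auto simp: offset_def)
  \<comment> \<open>The cases say whether the arc from \<open>i\<close> reaches \<open>i'\<close>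
    and whether the arc from \<open>i'\<close> wraps around to \<open>i\<close>.\<close>
  consider "k - c \<le> ?p" "?p + (k - d) \<le> n" | "?p < k - c" "?p + (k - d) \<le> n"
    | "?p < k - c" "n < ?p + (k - d)" | "k - c \<le> ?p" "n < ?p + (k - d)" by linarith
  then show ?thesis
  proof cases
    case 1
    then have "arc n i (k - c) \<inter> arc n i' (k - d) = {}"
      using disjoint_arcs[OF i i'] by (simp add: add.commute)
    then show ?thesis
      using card_arc[OF i, of "k - c"] card_arc[OF i', of "k - d"] k cd by (simp add: card_Un_disjoint)
  next
    case 2
    have "arc n i (?p + (k - d)) \<subseteq> arc n i (k - c) \<union> arc n i' (k - d)"
      using 2 by (auto simp: arc_def off' split: if_splits)
    then have "card (arc n i (?p + (k - d))) \<le> card (arc n i (k - c) \<union> arc n i' (k - d))"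
      by (intro card_mono) auto
    then show ?thesis using card_arc[OF i, of "?p + (k - d)"] 2 d cd by simp
  next
    case 3
    have "arc n i n \<subseteq> arc n i (k - c) \<union> arc n i' (k - d)"
      using 3 by (auto simp: arc_def off' split: if_splits)
    then have "card (arc n i n) \<le> card (arc n i (k - c) \<union> arc n i' (k - d))"
      by (intro card_mono) auto
    then show ?thesis using card_arc[OF i, of n] k by simp
  next
    case 4
    have "arc n i (k - c) \<union> arc n i' (n - ?p) \<subseteq> arc n i (k - c) \<union> arc n i' (k - d)"
      using 4 by (auto simp: arc_def)
    then have "card (arc n i (k - c) \<union> arc n i' (n - ?p)) \<le> card (arc n i (k - c) \<union> arc n i' (k - d))"
      by (intro card_mono) auto
    moreover have "arc n i (k - c) \<inter> arc n i' (n - ?p) = {}"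
      using disjoint_arcs[OF i i'] 4 c by simp
    ultimately show ?thesis
      using card_arc[OF i, of "k - c"] card_arc[OF i', of "n - ?p"] k cd c by (simp add: card_Un_disjoint)
  qed
qed

lemma offset_forward': 
  assumes "i \<in> {1..n}" "m \<in> {1..n}" "d < n"
  shows "offset n i (forward n m d) =
    (if offset n i m + d < n then offset n i m + d else offset n i m + d - n)"
  using assms by (auto simp: offset_def forward_def)

lemma offset_backward': 
  assumes "i \<in> {1..n}" "m \<in> {1..n}" "d < n"
  shows "offset n i (backward n m d) =
    (if d + 1 \<le> offset n i m then offset n i m - 1 - d else offset n i m + n - 1 - d)"
  using assms by (auto simp: offset_def backward_def)

lemma backward_offset:
  "i \<in> {1..n} \<Longrightarrow> x \<in> {1..n} \<Longrightarrow> backward n i (n - 1 - offset n i x) = x"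
  by (auto simp: offset_def backward_def)

lemma offset_swap:
  "i \<in> {1..n} \<Longrightarrow> j \<in> {1..n} \<Longrightarrow> i \<noteq> j \<Longrightarrow> offset n j i = n - offset n i j"
  by (auto simp: offset_def)

section \<open>Runs and cyclic components\<close>

text \<open>
  The size of the maximal run of elements of \<open>A\<close> that ends just before \<open>i\<close>.  For \<open>i \<notin> A\<close> a nonempty
  run is a cyclic component.
\<close>

definition run_length :: "nat \<Rightarrow> nat set \<Rightarrow> nat \<Rightarrow> nat" where
  "run_length n A i = (LEAST d. backward n i d \<notin> A)"

lemma run_length_eqI:
  "(\<And>d. d < l \<Longrightarrow> backward n i d \<in> A) \<Longrightarrow> backward n i l \<notin> A \<Longrightarrow> run_length n A i = l"
  unfolding run_length_def by (rule Least_equality) (auto simp: not_less[symmetric])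

lemma backward_in: "d < run_length n A i \<Longrightarrow> backward n i d \<in> A"
  unfolding run_length_def using not_less_Least by blast

lemma run_length_le: "backward n i d \<notin> A \<Longrightarrow> run_length n A i \<le> d"
  unfolding run_length_def by (rule Least_le)

lemma run_length_le_offset:
  assumes "i \<in> {1..n}" "x \<in> {1..n} - A"
  shows "run_length n A i + offset n i x < n"
proof -
  have "run_length n A i \<le> n - 1 - offset n i x"
    using assms backward_offset[of i n x] by (intro run_length_le) simp
  then show ?thesis using offset_less[of i n x] assms by simp
qed

lemma run_length_less:
  assumes "A \<subset> {1..n}" "i \<in> {1..n}"
  shows "run_length n A i < n"
proof -
  obtain x where "x \<in> {1..n} - A" using assms(1) by blast
  from run_length_le_offset[OF assms(2) this] show ?thesis by simp
qed

lemma backward_run_length: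
  assumes "A \<subset> {1..n}" "i \<in> {1..n}"
  shows "backward n i (run_length n A i) \<in> {1..n} - A"
proof -
  obtain x where x: "x \<in> {1..n} - A" using assms(1) by blast
  then have "backward n i (n - 1 - offset n i x) \<notin> A" using assms(2) backward_offset[of i n x] by simp
  then have "backward n i (run_length n A i) \<notin> A"
    unfolding run_length_def by (rule LeastI)
  then show ?thesis using backward_mem[OF assms(2) run_length_less[OF assms]] by blast
qed

text \<open>The greatest point under \<open><_i\<close> is the predecessor of \<open>i\<close>, so
  the maximum of the complement is the first point outside \<open>A\<close> met when counting
  backward from \<open>i\<close>.\<close>

lemma cyc_max_complement:
  assumes A: "A \<subset> {1..n}" and i: "i \<in> {1..n}"
  shows "cyc_max i ({1..n} - A) = backward n i (run_length n A i)"
  unfolding cyc_max_def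
proof (rule the_equality)
  let ?j = "backward n i (run_length n A i)"
  note j = backward_run_length[OF A i]
  have off: "offset n i ?j = n - 1 - run_length n A i"
    using offset_backward[OF i run_length_less[OF A i]] .
  have le: "cyc_le i x ?j" if "x \<in> {1..n} - A" for x
    using run_length_le_offset[OF i that] cyc_le_iff[OF i, of x ?j] that j off by simp
  then show "?j \<in> {1..n} - A \<and> (\<forall>x\<in>{1..n} - A. cyc_le i x ?j)" using j by blast
  fix y assume y: "y \<in> {1..n} - A \<and> (\<forall>x\<in>{1..n} - A. cyc_le i x y)"
  then have "cyc_le i ?j y" "cyc_le i y ?j" using j le by blast+
  then have "offset n i y = offset n i ?j" using y j cyc_le_iff[OF i] by (metis DiffD1 antisym)
  then show "y = ?j" using offset_inj[OF i] y j by blast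
qed

text \<open>Neither run can reach past the other point, because that point lies outside
  \<open>A\<close>. These are the separation bounds required by \<open>disjoint_arcs\<close> and
  \<open>card_union_arcs\<close>.\<close>

lemma run_length_separated:
  assumes "i \<in> {1..n} - A" "i' \<in> {1..n} - A" "i \<noteq> i'"
  shows "run_length n A i' < offset n i i'" and "run_length n A i + offset n i i' < n"
proof -
  show "run_length n A i + offset n i i' < n" using run_length_le_offset assms by blast
  have "run_length n A i' + offset n i' i < n" using run_length_le_offset assms by blast
  moreover have "offset n i' i = n - offset n i i'" using offset_swap[of i n i'] assms by blast
  ultimately show "run_length n A i' < offset n i i'" using offset_less[of i n i'] assms by simp
qed

lemma run_length_step:
  assumes A: "A \<subset> {1..n}" and i: "i \<in> A"
  shows "run_length n A (forward n i 1) = run_length n A i + 1"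
proof (rule run_length_eqI)
  have i': "i \<in> {1..n}" using A i by blast
  note less = run_length_less[OF A i']
  have zero: "backward n (forward n i 1) 0 = i"
    using i' by (auto simp: backward_def forward_def)
  have suc: "backward n (forward n i 1) (Suc d) = backward n i d" if "Suc d < n" for d
    using i' that by (auto simp: backward_def forward_def)
  show "backward n (forward n i 1) d \<in> A" if "d < run_length n A i + 1" for d
    using that i zero suc less backward_in by (cases d) auto
  \<comment> \<open>A run of length \<open>n - 1\<close> would be stopped by \<open>i\<close>
    itself, but \<open>i\<close> is in \<open>A\<close>. Hence \<open>suc\<close> may be applied to
    the point that stops the run.\<close>
  have "run_length n A i + 1 \<noteq> n"
  proof
    assume eq: "run_length n A i + 1 = n"
    then have "backward n i (run_length n A i) = i" using i' by (auto simp: backward_def)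
    then show False using backward_run_length[OF A i'] i by simp
  qed
  then show "backward n (forward n i 1) (run_length n A i + 1) \<notin> A"
    using suc[of "run_length n A i"] less backward_run_length[OF A i'] by simp
qed

text \<open>Reduces questions about an arbitrary \<open>i\<close> to points outside
  \<open>A\<close>: on the way forward through \<open>A\<close>, the run grows by one at each
  step.\<close>

lemma next_outside:
  assumes A: "A \<subset> {1..n}" and i: "i \<in> {1..n}"
  obtains m where "m < n" "forward n i m \<in> {1..n} - A"
    "run_length n A (forward n i m) = run_length n A i + m"
    "\<And>d. d < m \<Longrightarrow> forward n i d \<in> A"
proof -
  obtain x where x: "x \<in> {1..n} - A" using A by blast
  define m where "m = (LEAST m. forward n i m \<notin> A)"
  have ex: "forward n i (offset n i x) \<notin> A" using x i by (simp add: forward_offset)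
  have out: "forward n i m \<notin> A" unfolding m_def by (rule LeastI[of _ "offset n i x"]) (rule ex)
  have "m \<le> offset n i x" unfolding m_def by (rule Least_le) (rule ex)
  then have m: "m < n" using offset_less[OF i, of x] x by simp
  have mem: "forward n i d \<in> A" if "d < m" for d
    using that unfolding m_def using not_less_Least by blast
  have "run_length n A (forward n i d) = run_length n A i + d" if "d \<le> m" for d
    using that
  proof (induction d)
    case 0
    then show ?case using i by (auto simp: forward_def)
  next
    case (Suc d)
    have "forward n (forward n i d) 1 = forward n i (Suc d)"
      using i Suc.prems m by (auto simp: forward_def)
    then show ?case using run_length_step[OF A mem[of d]] Suc by simp
  qed
  then show thesis using that[of m] m out forward_mem[OF i m] mem by blast
qed

section \<open>Cyclic components as runs\<close>

lemma cyc_interval_backward: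
  assumes i: "i \<in> {1..n}" and l: "l < n"
  shows "cyc_interval n (backward n i l) (backward n i 0) = backward n i ` {..l}"
proof -
  let ?a = "backward n i l"
  have a: "?a \<in> {1..n}" and b: "backward n i 0 \<in> {1..n}" using backward_mem[OF i] l by auto
  have off: "offset n ?a (backward n i d) = l - d" if "d \<le> l" for d
    using i l that by (auto simp: backward_def offset_def)
  have inv: "backward n i (l - offset n ?a x) = x" if "x \<in> {1..n}" "offset n ?a x \<le> l" for x
    using i l that by (auto simp: backward_def offset_def split: if_splits)
  have int: "cyc_interval n ?a (backward n i 0) = {x \<in> {1..n}. offset n ?a x \<le> l}"
    unfolding cyc_interval_def using cyc_le_iff[OF a _ b] off[of 0] by auto
  show ?thesis
    unfolding int
  proof (intro equalityI subsetI)
    fix x assume "x \<in> {x \<in> {1..n}. offset n ?a x \<le> l}"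
    then show "x \<in> backward n i ` {..l}" using inv[of x] by (intro image_eqI[of _ _ "l - offset n ?a x"]) auto
  next
    fix x assume "x \<in> backward n i ` {..l}"
    then show "x \<in> {x \<in> {1..n}. offset n ?a x \<le> l}" using off backward_mem[OF i] l by force
  qed
qed

lemma backward_inj:
  "i \<in> {1..n} \<Longrightarrow> d < n \<Longrightarrow> d' < n \<Longrightarrow> backward n i d = backward n i d' \<Longrightarrow> d = d'"
  by (auto simp: backward_def split: if_splits)

text \<open>Measured from \<open>i\<close>, the run before \<open>i'\<close> lies strictly between
  \<open>i\<close> and \<open>i'\<close>, while the run before \<open>i\<close> lies beyond
  \<open>i'\<close>.\<close>

lemma runs_disjoint:
  assumes A: "A \<subset> {1..n}" and i: "i \<in> {1..n} - A" and i': "i' \<in> {1..n} - A" and ne: "i \<noteq> i'"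
  shows "backward n i ` {..<run_length n A i} \<inter> backward n i' ` {..<run_length n A i'} = {}"
proof -
  have "backward n i d \<noteq> backward n i' d'"
    if d: "d < run_length n A i" and d': "d' < run_length n A i'" for d d'
  proof
    assume eq: "backward n i d = backward n i' d'"
    have "d < n" "d' < n" using d d' run_length_less[OF A] i i' by (meson DiffD1 less_trans)+
    moreover have "offset n i i' < n" using offset_less i i' by blast
    ultimately show False
      using run_length_separated[OF i i' ne] d d' eq offset_backward[of i n d]
        offset_backward'[of i n i' d'] i i' by (auto split: if_splits)
  qed
  then show ?thesis by blast
qed

text \<open>A component is indexed by the first point after it, so these points lie outside
  \<open>A\<close>.\<close>

definition run_ends :: "nat \<Rightarrow> nat set \<Rightarrow> nat set" where
  "run_ends n A = {i \<in> {1..n} - A. 0 < run_length n A i}"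

definition run_bounds :: "nat \<Rightarrow> nat set \<Rightarrow> nat \<Rightarrow> nat \<times> nat" where
  "run_bounds n A i = (backward n i (run_length n A i - 1), backward n i 0)"

lemma cyc_interval_run_bounds:
  assumes A: "A \<subset> {1..n}" and i: "i \<in> run_ends n A"
  shows "(case run_bounds n A i of (a, b) \<Rightarrow> cyc_interval n a b) = backward n i ` {..<run_length n A i}"
proof -
  have i': "i \<in> {1..n}" "0 < run_length n A i" using i by (auto simp: run_ends_def)
  have "{..run_length n A i - 1} = {..<run_length n A i}" using i'(2) by auto
  then show ?thesis
    using cyc_interval_backward[OF i'(1), of "run_length n A i - 1"] run_length_less[OF A i'(1)]
    by (simp add: run_bounds_def)
qed

lemma forward_1_mod:
  assumes "b \<in> {1..n}" "a \<in> {1..n}"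
  shows "(b + 1) mod n = a mod n \<longleftrightarrow> forward n b 1 = a"
proof (cases "b = n")
  case True
  show ?thesis
  proof (cases "n = 1")
    case False
    then have "(b + 1) mod n = 1" using True assms by (simp add: mod_Suc)
    moreover have "a mod n = (if a = n then 0 else a)" using assms by auto
    ultimately show ?thesis using True False assms by (auto simp: forward_def)
  qed (use assms in \<open>auto simp: forward_def\<close>)
next
  case False
  then have "(b + 1) mod n = (if b + 1 = n then 0 else b + 1)" using assms by auto
  moreover have "a mod n = (if a = n then 0 else a)" using assms by auto
  ultimately show ?thesis using False assms by (auto simp: forward_def)
qed

text \<open>Existence of the decomposition. An element of \<open>A\<close> lies in the run before
  the next point outside \<open>A\<close>. No two runs are adjacent, since the successor of a run
  lies outside \<open>A\<close> while every run starts inside \<open>A\<close>.\<close>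

lemma cyclic_decomposition_run_bounds:
  assumes A: "A \<subset> {1..n}"
  shows "cyclic_decomposition n A (run_bounds n A ` run_ends n A)"
  unfolding cyclic_decomposition_def
proof (intro conjI)
  let ?I = "\<lambda>p. case p of (a, b) \<Rightarrow> cyc_interval n a b"
  have mem: "i \<in> {1..n}" "i \<notin> A" "0 < run_length n A i" "run_length n A i < n" if "i \<in> run_ends n A" for i
    using that run_length_less[OF A] by (auto simp: run_ends_def)
  show "run_bounds n A ` run_ends n A \<subseteq> {1..n} \<times> {1..n}"
  proof
    fix p assume "p \<in> run_bounds n A ` run_ends n A"
    then obtain i where i: "i \<in> run_ends n A" "p = run_bounds n A i" by blast
    show "p \<in> {1..n} \<times> {1..n}"
      using backward_mem[OF mem(1)[OF i(1)]] mem[OF i(1)] i(2) unfolding run_bounds_def by simp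
  qed
  show "A = (\<Union>p\<in>run_bounds n A ` run_ends n A. ?I p)"
  proof
    show "(\<Union>p\<in>run_bounds n A ` run_ends n A. ?I p) \<subseteq> A"
    proof
      fix x assume "x \<in> (\<Union>p\<in>run_bounds n A ` run_ends n A. ?I p)"
      then obtain i where i: "i \<in> run_ends n A" "x \<in> ?I (run_bounds n A i)" by (elim UN_E imageE) simp
      have "x \<in> backward n i ` {..<run_length n A i}"
        using i(2) unfolding cyc_interval_run_bounds[OF A i(1)] .
      then obtain d where "d < run_length n A i" "x = backward n i d" by (elim imageE) simp
      then show "x \<in> A" using backward_in by simp
    qed
    show "A \<subseteq> (\<Union>p\<in>run_bounds n A ` run_ends n A. ?I p)"
    proof
      fix x assume x: "x \<in> A"
      then have x': "x \<in> {1..n}" using A by blast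
      obtain m where m: "m < n" "forward n x m \<in> {1..n} - A"
        "run_length n A (forward n x m) = run_length n A x + m"
        using next_outside[OF A x'] by blast
      have "m \<noteq> 0"
      proof
        assume "m = 0"
        then have "forward n x m = x" using x' by (simp add: forward_def)
        then show False using m(2) x by simp
      qed
      then have e: "forward n x m \<in> run_ends n A" using m by (simp add: run_ends_def)
      have "backward n (forward n x m) (m - 1) = x"
        using x' m(1) \<open>m \<noteq> 0\<close> by (auto simp: forward_def backward_def)
      then have "x \<in> backward n (forward n x m) ` {..<run_length n A (forward n x m)}"
        using m(3) \<open>m \<noteq> 0\<close> by (intro image_eqI[of _ _ "m - 1"]) auto
      then have "x \<in> ?I (run_bounds n A (forward n x m))"
        unfolding cyc_interval_run_bounds[OF A e] .
      then show "x \<in> (\<Union>p\<in>run_bounds n A ` run_ends n A. ?I p)"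
        by (rule UN_I[OF imageI[OF e]])
    qed
  qed
  show "disjoint_family_on ?I (run_bounds n A ` run_ends n A)"
    unfolding disjoint_family_on_def
  proof (intro ballI impI)
    fix p q assume "p \<in> run_bounds n A ` run_ends n A" "q \<in> run_bounds n A ` run_ends n A" "p \<noteq> q"
    then obtain i i' where i: "i \<in> run_ends n A" "i' \<in> run_ends n A" "i \<noteq> i'"
      "p = run_bounds n A i" "q = run_bounds n A i'" by blast
    show "?I p \<inter> ?I q = {}"
      unfolding i(4,5) cyc_interval_run_bounds[OF A i(1)] cyc_interval_run_bounds[OF A i(2)]
      using i mem by (intro runs_disjoint[OF A]) auto
  qed
  have "(snd (run_bounds n A i) + 1) mod n \<noteq> fst (run_bounds n A i') mod n"
    if i: "i \<in> run_ends n A" "i' \<in> run_ends n A" for i i'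
  proof -
    note m = mem[OF i(1)] and m' = mem[OF i(2)]
    have "backward n i' (run_length n A i' - 1) \<in> A" using m' by (intro backward_in) simp
    moreover have "forward n (backward n i 0) 1 = i" using m by (auto simp: forward_def backward_def)
    ultimately have "forward n (backward n i 0) 1 \<noteq> backward n i' (run_length n A i' - 1)"
      using m(2) by metis
    moreover have "backward n i 0 \<in> {1..n}" "backward n i' (run_length n A i' - 1) \<in> {1..n}"
      using backward_mem[OF m(1), of 0] backward_mem[OF m'(1), of "run_length n A i' - 1"] m m'
      by simp_all
    ultimately show ?thesis unfolding run_bounds_def fst_conv snd_conv by (simp only: forward_1_mod not_False_eq_True)
  qed
  then show "\<forall>(a, b)\<in>run_bounds n A ` run_ends n A.
      \<forall>(a', b')\<in>run_bounds n A ` run_ends n A. (b + 1) mod n \<noteq> a' mod n"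
    by (simp only: ball_simps case_prod_beta) blast
qed

text \<open>If the successor of \<open>b\<close> were in \<open>A\<close>, the interval containing
  it would not start there by nonadjacency, so it would also contain \<open>b\<close> and, by
  disjointness, be the interval from \<open>a\<close> to \<open>b\<close>; but that one stops at
  \<open>b\<close>. The argument at \<open>a\<close> is the mirror image.\<close>

lemma cyclic_decomposition_endpoints:
  assumes P: "cyclic_decomposition n A P" and ab: "(a, b) \<in> P"
  shows "a \<in> {1..n}" "b \<in> {1..n}" "forward n b 1 \<notin> A" "backward n a 0 \<notin> A" "forward n b 1 \<noteq> a"
proof -
  have sub: "P \<subseteq> {1..n} \<times> {1..n}" and A: "A = (\<Union>(a, b)\<in>P. cyc_interval n a b)"
    and disj: "disjoint_family_on (\<lambda>(a, b). cyc_interval n a b) P"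
    and nonadj: "\<forall>(a, b)\<in>P. \<forall>(a', b')\<in>P. (b + 1) mod n \<noteq> a' mod n"
    using P unfolding cyclic_decomposition_def by blast+
  have mem: "c \<in> {1..n} \<and> d \<in> {1..n}" if "(c, d) \<in> P" for c d
    using that sub by blast
  have nonadj': "forward n d 1 \<noteq> c'" if "(c, d) \<in> P" "(c', d') \<in> P" for c d c' d'
  proof -
    have "(d + 1) mod n \<noteq> c' mod n" using bspec[OF bspec[OF nonadj that(1), unfolded prod.case] that(2)] by simp
    then show ?thesis using forward_1_mod[of d n c'] mem that by blast
  qed
  have int: "x \<in> cyc_interval n c d \<longleftrightarrow> x \<in> {1..n} \<and> offset n c x \<le> offset n c d"
    if "(c, d) \<in> P" for c d x
    using cyc_le_iff[of c n x d] mem[OF that] unfolding cyc_interval_def by blast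
  have unique: "(c, d) = (c', d')"
    if "(c, d) \<in> P" "(c', d') \<in> P" "x \<in> cyc_interval n c d" "x \<in> cyc_interval n c' d'" for c d c' d' x
    using disjoint_family_onD[OF disj that(1,2)] that(3,4) by auto
  have covered: "\<exists>c d. (c, d) \<in> P \<and> x \<in> cyc_interval n c d" if "x \<in> A" for x
    using that unfolding A by auto
  show a: "a \<in> {1..n}" and b: "b \<in> {1..n}" using mem[OF ab] by auto
  show ne: "forward n b 1 \<noteq> a" by (rule nonadj'[OF ab ab])
  show "forward n b 1 \<notin> A"
  proof
    assume "forward n b 1 \<in> A"
    then obtain c d where cd: "(c, d) \<in> P" "forward n b 1 \<in> cyc_interval n c d" using covered by blast
    have c: "c \<in> {1..n}" using mem[OF cd(1)] by blast
    have "offset n c b \<le> offset n c (forward n b 1)"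
      using nonadj'[OF ab cd(1)] b c by (auto simp: offset_def forward_def split: if_splits)
    then have "b \<in> cyc_interval n c d" using cd b int[OF cd(1)] by (meson le_trans)
    moreover have "b \<in> cyc_interval n a b" using int[OF ab] b by simp
    ultimately have "(a, b) = (c, d)" using unique[OF ab cd(1)] by blast
    then have "offset n a (forward n b 1) \<le> offset n a b" using cd(2) int[OF ab] by simp
    then show False using ne a b by (auto simp: offset_def forward_def split: if_splits)
  qed
  show "backward n a 0 \<notin> A"
  proof
    let ?j = "backward n a 0"
    have j: "forward n ?j 1 = a" using a by (auto simp: forward_def backward_def)
    assume "?j \<in> A"
    then obtain c d where cd: "(c, d) \<in> P" "?j \<in> cyc_interval n c d" using covered by blast
    have c: "c \<in> {1..n}" and d: "d \<in> {1..n}" using mem[OF cd(1)] by blast+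
    have jd: "?j \<noteq> d" using nonadj'[OF cd(1) ab] j by blast
    have jm: "?j \<in> {1..n}" and le: "offset n c ?j \<le> offset n c d" using cd(2) int[OF cd(1)] by blast+
    have "offset n c ?j \<noteq> offset n c d" using jd offset_inj[OF c jm d] by blast
    then have "offset n c a \<le> offset n c d"
      using le a c d by (auto simp: offset_def backward_def split: if_splits)
    then have "a \<in> cyc_interval n c d" using int[OF cd(1)] a by blast
    moreover have "a \<in> cyc_interval n a b" using int[OF ab] a by simp
    ultimately have "(a, b) = (c, d)" using unique[OF ab cd(1)] by blast
    then have "offset n a ?j < offset n a b"
      using le \<open>offset n c ?j \<noteq> offset n c d\<close> by simp
    then show False using offset_less[OF a b] offset_backward[OF a, of 0] a by simp
  qed
qed

text \<open>Both neighbours of the interval lie outside \<open>A\<close>, so it is the whole run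
  ending just before the successor of \<open>b\<close>.\<close>

lemma cyclic_decomposition_run_boundsD:
  assumes P: "cyclic_decomposition n A P" and ab: "(a, b) \<in> P"
  shows "forward n b 1 \<in> run_ends n A" "(a, b) = run_bounds n A (forward n b 1)"
proof -
  note ends = cyclic_decomposition_endpoints[OF P ab]
  let ?i = "forward n b 1" and ?l = "offset n a b"
  have A: "A = (\<Union>(a, b)\<in>P. cyc_interval n a b)"
    using P unfolding cyclic_decomposition_def by blast
  have sub: "cyc_interval n a b \<subseteq> A" unfolding A using ab by blast
  have i: "?i \<in> {1..n}" using ends(2) by (auto simp: forward_def)
  have l: "?l + 1 < n" using ends(1,2,5) by (auto simp: forward_def offset_def split: if_splits)
  have a_eq: "backward n ?i ?l = a" using ends(1,2,5) by (auto simp: forward_def offset_def backward_def)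
  have b_eq: "backward n ?i 0 = b" using ends(1,2) by (auto simp: forward_def backward_def)
  have "cyc_interval n a b = backward n ?i ` {..?l}"
    using cyc_interval_backward[OF i, of ?l] l unfolding a_eq b_eq by simp
  then have in_A: "backward n ?i d \<in> A" if "d < ?l + 1" for d
    using that sub by auto
  have "backward n ?i (?l + 1) = backward n a 0"
    using ends(1,2,5) by (auto simp: forward_def offset_def backward_def)
  then have run: "run_length n A ?i = ?l + 1"
    using in_A ends(4) by (intro run_length_eqI) auto
  show "?i \<in> run_ends n A" using run i ends(3) by (simp add: run_ends_def)
  show "(a, b) = run_bounds n A ?i" using run a_eq b_eq by (simp add: run_bounds_def)
qed

text \<open>Justifies the definite description in \<open>cyclic_components\<close>. For the second
  inclusion, the interval of \<open>P\<close> through the predecessor of \<open>i\<close> turns out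
  to be the run before \<open>i\<close>.\<close>

lemma cyclic_decomposition_unique:
  assumes P: "cyclic_decomposition n A P"
  shows "P = run_bounds n A ` run_ends n A"
proof
  show "P \<subseteq> run_bounds n A ` run_ends n A"
  proof
    fix p assume p: "p \<in> P"
    obtain a b where ab: "p = (a, b)" by fastforce
    from cyclic_decomposition_run_boundsD[OF P p[unfolded ab]]
    show "p \<in> run_bounds n A ` run_ends n A" unfolding ab by (rule rev_image_eqI)
  qed
  show "run_bounds n A ` run_ends n A \<subseteq> P"
  proof
    fix p assume "p \<in> run_bounds n A ` run_ends n A"
    then obtain i where i: "i \<in> run_ends n A" "p = run_bounds n A i" by (elim imageE) simp
    have i': "i \<in> {1..n}" "i \<notin> A" "0 < run_length n A i" using i(1) by (auto simp: run_ends_def)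
    have A: "A = (\<Union>(a, b)\<in>P. cyc_interval n a b)"
      using P unfolding cyclic_decomposition_def by blast
    have "backward n i 0 \<in> A" using backward_in i'(3) by blast
    then obtain a b where ab: "(a, b) \<in> P" "backward n i 0 \<in> cyc_interval n a b" using A by auto
    note D = cyclic_decomposition_run_boundsD[OF P ab(1)] and ends = cyclic_decomposition_endpoints[OF P ab(1)]
    let ?i = "forward n b 1"
    have i'': "?i \<in> {1..n}" using D(1) by (simp add: run_ends_def)
    have "A \<subseteq> {1..n}" unfolding A by (auto simp: cyc_interval_def)
    then have sub: "A \<subset> {1..n}" using i' by blast
    have b: "b = backward n ?i 0" using ends(1,2) by (auto simp: forward_def backward_def)
    have "backward n i 0 \<in> backward n ?i ` {..<run_length n A ?i}"
      using cyc_interval_run_bounds[OF sub D(1)] ab(2) unfolding D(2)[symmetric] by simp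
    then obtain d where d: "d < run_length n A ?i" "backward n i 0 = backward n ?i d"
      by (elim imageE) simp
    have dn: "d < n" using d(1) run_length_less[OF sub i''] by simp
    \<comment> \<open>For \<open>d > 0\<close> the successor of this element, which is
      \<open>i\<close>, would still belong to the run and hence to \<open>A\<close>.\<close>
    have "d = 0"
    proof (rule ccontr)
      assume "d \<noteq> 0"
      then have "i = backward n ?i (d - 1)"
        using d(2) dn i'(1) i'' unfolding backward_def by (auto split: if_splits)
      moreover have "backward n ?i (d - 1) \<in> A" using d(1) by (intro backward_in) simp
      ultimately show False using i'(2) by simp
    qed
    then have "backward n i 0 = b" using d(2) b by simp
    moreover have "forward n (backward n i 0) 1 = i" using i'(1) by (auto simp: forward_def backward_def)
    ultimately have "i = ?i" by simp
    then show "p \<in> P" using i(2) D(2) ab(1) by simp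
  qed
qed

lemma cyclic_components_eq:
  assumes A: "A \<subset> {1..n}"
  shows "cyclic_components n A = (\<lambda>i. backward n i ` {..<run_length n A i}) ` run_ends n A"
proof -
  have "(THE P. cyclic_decomposition n A P) = run_bounds n A ` run_ends n A"
    using cyclic_decomposition_run_bounds[OF A] cyclic_decomposition_unique by (rule the_equality)
  then show ?thesis
    unfolding cyclic_components_def by (simp add: image_image cyc_interval_run_bounds[OF A] cong: image_cong)
qed

text \<open>Points with an empty run add nothing to the sums, so all points outside \<open>A\<close>
  may be used instead of \<open>run_ends\<close>. The bound on a single run comes from letting the
  two components coincide.\<close>

lemma component_unions_bounded_iff:
  assumes A: "A \<subset> {1..n}"
  shows "component_unions_bounded n A m \<longleftrightarrow>
    (\<forall>i\<in>{1..n} - A. run_length n A i \<le> m) \<and>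
    (\<forall>i\<in>{1..n} - A. \<forall>i'\<in>{1..n} - A. i \<noteq> i' \<longrightarrow> run_length n A i + run_length n A i' \<le> m)"
    (is "?L \<longleftrightarrow> ?R")
proof -
  define C where "C = (\<lambda>i. backward n i ` {..<run_length n A i})"
  have card: "card (C i) = run_length n A i" if "i \<in> {1..n} - A" for i
  proof -
    have "inj_on (backward n i) {..<run_length n A i}"
      using that backward_inj[of i n] run_length_less[OF A, of i] by (intro inj_onI) auto
    then show ?thesis by (simp add: C_def card_image)
  qed
  have card2: "card (C i \<union> C i') = run_length n A i + run_length n A i'"
    if "i \<in> {1..n} - A" "i' \<in> {1..n} - A" "i \<noteq> i'" for i i'
    using runs_disjoint[OF A that] card[OF that(1)] card[OF that(2)]
    by (subst card_Un_disjoint) (simp_all add: C_def)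
  have L: "?L \<longleftrightarrow> (\<forall>i\<in>run_ends n A. \<forall>i'\<in>run_ends n A. card (C i \<union> C i') \<le> m)"
    unfolding component_unions_bounded_def cyclic_components_eq[OF A] C_def by simp
  show ?thesis
  proof
    assume ?L
    then have bound: "card (C i \<union> C i') \<le> m" if "i \<in> run_ends n A" "i' \<in> run_ends n A" for i i'
      using that L by blast
    have single: "run_length n A i \<le> m" if "i \<in> {1..n} - A" for i
      using bound[of i i] card[OF that] that by (cases "run_length n A i = 0") (auto simp: run_ends_def)
    have "run_length n A i + run_length n A i' \<le> m"
      if "i \<in> {1..n} - A" "i' \<in> {1..n} - A" "i \<noteq> i'" for i i'
      using bound[of i i'] card2[OF that] single[OF that(1)] single[OF that(2)] that
      by (cases "run_length n A i = 0"; cases "run_length n A i' = 0") (auto simp: run_ends_def)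
    then show ?R using single by blast
  next
    assume R: ?R
    have "card (C i \<union> C i') \<le> m" if "i \<in> run_ends n A" "i' \<in> run_ends n A" for i i'
    proof -
      have i: "i \<in> {1..n} - A" "i' \<in> {1..n} - A" using that by (auto simp: run_ends_def)
      show ?thesis
        using card[OF i(1)] card2[OF i] R i by (cases "i = i'") auto
    qed
    then show ?L using L by blast
  qed
qed

lemma run_length_less_bound:
  assumes A: "A \<subset> {1..n}" and bound: "\<And>i. i \<in> {1..n} - A \<Longrightarrow> run_length n A i < k" and i: "i \<in> {1..n}"
  shows "run_length n A i < k"
proof -
  obtain m where "forward n i m \<in> {1..n} - A" "run_length n A (forward n i m) = run_length n A i + m"
    using next_outside[OF A i] by blast
  then show ?thesis using bound[of "forward n i m"] by simp
qed

section \<open>The positroid of a shifted uniform permutation\<close>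

text \<open>The maximum of the complement of \<open>A\<close> under \<open><_i\<close>, moved
  forward by \<open>k\<close>. It is the point that the necklace set at \<open>i\<close> omits from
  \<open>arc n i k\<close>.\<close>

definition necklace_gap :: "nat \<Rightarrow> nat \<Rightarrow> nat set \<Rightarrow> nat \<Rightarrow> nat" where
  "necklace_gap n k A i = forward n (backward n i (run_length n A i)) k"

lemma necklace_gap:
  assumes A: "A \<subset> {1..n}" and k: "k < n" and i: "i \<in> {1..n}" and l: "run_length n A i < k"
  shows "necklace_gap n k A i \<in> {1..n}" "offset n i (necklace_gap n k A i) = k - 1 - run_length n A i"
proof -
  have b: "backward n i (run_length n A i) \<in> {1..n}" using backward_run_length[OF A i] by blast
  then show "necklace_gap n k A i \<in> {1..n}"
    unfolding necklace_gap_def using forward_mem k by blast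
  show "offset n i (necklace_gap n k A i) = k - 1 - run_length n A i"
    unfolding necklace_gap_def using offset_forward'[OF i b k] offset_backward[OF i, of "run_length n A i"] k l
    by simp
qed

lemma uniform_perm_forward:
  "k < n \<Longrightarrow> i \<in> {1..n} \<Longrightarrow> fst (uniform_perm k n) i = forward n i k"
  by (auto simp: uniform_perm_def forward_def mod_if)

text \<open>No colour is \<open>-1\<close>, so \<open>j = p m\<close> is in the necklace set iff it
  precedes \<open>m\<close> under \<open><_i\<close>. For \<open>m\<close> in \<open>A\<close> it
  lies \<open>k\<close> steps after \<open>m\<close>, and this means that it is among the first
  \<open>k\<close> points. For \<open>m\<close> outside \<open>A\<close> it lies \<open>k\<close>
  steps after the previous point \<open>x\<close> outside \<open>A\<close>. The criterion is the
  same unless the way back from \<open>m\<close> to \<open>x\<close> passes \<open>i\<close>; then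
  \<open>p m\<close> is the gap and does not precede \<open>m\<close>.\<close>

lemma grassmann_necklace_cyclic_shift:
  assumes A: "A \<subset> {1..n}" and k: "k < n"
    and bound: "\<And>i. i \<in> {1..n} - A \<Longrightarrow> run_length n A i < k"
    and s: "decorated_permutation n (cyclic_shift n A (uniform_perm k n))"
    and i: "i \<in> {1..n}"
  shows "grassmann_necklace n (cyclic_shift n A (uniform_perm k n)) i = arc n i k - {necklace_gap n k A i}"
proof -
  obtain p col where pc: "cyclic_shift n A (uniform_perm k n) = (p, col)" by fastforce
  have perm: "p permutes {1..n}" using s unfolding pc decorated_permutation_def by simp
  have col: "col j \<noteq> -1" for j
    using pc unfolding cyclic_shift_def uniform_perm_def Let_def by (auto split: if_splits)
  have p_in: "p m = forward n m k" if "m \<in> A" for m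
    using pc uniform_perm_forward[OF k, of m] that A unfolding cyclic_shift_def Let_def
    by (auto simp: case_prod_beta)
  have p_out: "p m = forward n (backward n m (run_length n A m)) k" if "m \<in> {1..n} - A" for m
  proof -
    have "p m = fst (uniform_perm k n) (cyc_max m ({1..n} - A))"
      using pc that unfolding cyclic_shift_def Let_def by (auto simp: case_prod_beta)
    also have "cyc_max m ({1..n} - A) = backward n m (run_length n A m)"
      using cyc_max_complement[OF A] that by blast
    finally show ?thesis using uniform_perm_forward[OF k] backward_run_length[OF A, of m] that by simp
  qed
  have forward_inj: "x = y" if "x \<in> {1..n}" "y \<in> {1..n}" "forward n x k = forward n y k" for x y
    using that k by (auto simp: forward_def split: if_splits)
  let ?L = "run_length n A i"
  define y where "y = backward n i ?L"
  have y: "y \<in> {1..n}" "y \<notin> A" using backward_run_length[OF A i] by (auto simp: y_def)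
  have off_y: "offset n i y = n - 1 - ?L" and Ln: "?L < n"
    using offset_backward[OF i] run_length_less[OF A i] by (auto simp: y_def)
  have gap: "necklace_gap n k A i = forward n y k" by (simp add: necklace_gap_def y_def)
  have key: "offset n i (p m) < offset n i m \<longleftrightarrow> offset n i (p m) < k \<and> p m \<noteq> necklace_gap n k A i"
    if m: "m \<in> {1..n}" for m
  proof (cases "m \<in> A")
    case True
    have "forward n m k \<noteq> forward n y k" using forward_inj[OF m y(1)] True y(2) by blast
    then show ?thesis
      using p_in[OF True] gap offset_forward'[OF i m k] offset_less[OF i m] k by auto
  next
    case False
    define l where "l = run_length n A m"
    define x where "x = backward n m l"
    have m': "m \<in> {1..n} - A" using m False by simp
    have pm: "p m = forward n x k" using p_out[OF m'] by (simp add: x_def l_def)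
    have l: "l < k" using bound[OF m'] by (simp add: l_def)
    have x: "x \<in> {1..n}" "x \<notin> A" using backward_run_length[OF A m] by (auto simp: x_def l_def)
    have xgap: "p m = necklace_gap n k A i \<longleftrightarrow> x = y" using pm gap forward_inj[OF x(1) y(1)] by auto
    have off_x: "offset n i x = (if l + 1 \<le> offset n i m then offset n i m - 1 - l else offset n i m + n - 1 - l)"
      using offset_backward'[OF i m, of l] l k by (simp add: x_def)
    have off_px: "offset n i (p m) = (if offset n i x + k < n then offset n i x + k else offset n i x + k - n)"
      unfolding pm by (rule offset_forward'[OF i x(1) k])
    have m_le: "?L + offset n i m < n" by (rule run_length_le_offset[OF i m'])
    have x_le: "?L + offset n i x < n" using run_length_le_offset[OF i] x by blast
    show ?thesis
    proof (cases "l + 1 \<le> offset n i m")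
      case True
      then have "x \<noteq> y" using off_x off_y m_le by auto
      then show ?thesis using xgap off_px off_x True l k offset_less[OF i m] by auto
    next
      case wrap: False
      \<comment> \<open>Here \<open>m\<close> is the first point outside \<open>A\<close> at or
        after \<open>i\<close>, so going back from it leads to the maximum \<open>y\<close> of the
        complement under \<open><_i\<close>.\<close>
      have "x = y"
      proof (rule ccontr)
        assume "x \<noteq> y"
        then have "offset n i x \<noteq> offset n i y" using offset_inj[OF i x(1) y(1)] by blast
        then have less: "offset n i x < offset n i y" using x_le off_y by linarith
        \<comment> \<open>If \<open>y\<close> came after \<open>x\<close> under \<open><_i\<close>,
          it would be met before \<open>x\<close> on the way back from \<open>m\<close>, at position
          \<open>d\<close> of a run inside \<open>A\<close>.\<close>
        define d where "d = offset n i m + n - 1 - offset n i y"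
        have d: "d < l" using less off_x off_y wrap Ln unfolding d_def by simp
        have "offset n i (backward n m d) = offset n i y"
          using offset_backward'[OF i m, of d] d l k off_y m_le Ln unfolding d_def by auto
        then have "backward n m d = y"
          using offset_inj[OF i _ y(1)] backward_mem[OF m, of d] d l k by auto
        moreover have "backward n m d \<in> A" using backward_in d unfolding l_def by blast
        ultimately show False using y(2) by simp
      qed
      then show ?thesis using xgap off_px off_x wrap l k offset_less[OF i m] by auto
    qed
  qed
  show ?thesis
  proof (rule set_eqI)
    fix j
    show "j \<in> grassmann_necklace n (cyclic_shift n A (uniform_perm k n)) i \<longleftrightarrow>
        j \<in> arc n i k - {necklace_gap n k A i}"
    proof (cases "j \<in> {1..n}")
      case True
      define m where "m = inv p j"
      have pm: "p m = j" using permutes_inverses(1)[OF perm] by (simp add: m_def)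
      have m: "m \<in> {1..n}" using permutes_in_image[OF perm, of m] pm True by simp
      have "j \<in> grassmann_necklace n (p, col) i \<longleftrightarrow> offset n i j < offset n i m"
        using cyc_less_iff[OF i True m] col[of j] True by (simp add: grassmann_necklace_def m_def)
      then show ?thesis using key[OF m] True unfolding pc pm by (simp add: arc_def)
    next
      case False
      then show ?thesis by (auto simp: grassmann_necklace_def arc_def pc)
    qed
  qed
qed

lemma arc_forward_subset:
  assumes i: "i \<in> {1..n}" and m: "m < n" "m \<le> l"
  shows "arc n (forward n i m) (l - m) \<subseteq> arc n i l"
proof
  fix x assume x: "x \<in> arc n (forward n i m) (l - m)"
  have "offset n i x \<le> offset n (forward n i m) x + m" if "x \<in> {1..n}"
    using i m that by (auto simp: offset_def forward_def)
  then show "x \<in> arc n i l" using x m by (auto simp: arc_def)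
qed

text \<open>Only points outside \<open>A\<close> matter: moving from \<open>i\<close> to the next
  point outside \<open>A\<close> shortens the arc from the front and keeps its end, so avoiding the
  shorter arc implies avoiding the longer one.\<close>

lemma bases_positroid_runs:
  assumes A: "A \<subset> {1..n}" and k: "k < n"
    and bound: "\<And>i. i \<in> {1..n} - A \<Longrightarrow> run_length n A i < k"
    and I: "\<And>i. i \<in> {1..n} \<Longrightarrow> grassmann_necklace n s i = arc n i k - {necklace_gap n k A i}"
  shows "bases (positroid n s) = {B. B \<subseteq> {1..n} \<and> card B = k - 1 \<and>
    (\<forall>S\<in>(\<lambda>i. arc n i (k - run_length n A i)) ` ({1..n} - A). \<not> S \<subseteq> B)}"
proof -
  have l: "run_length n A i < k" if "i \<in> {1..n}" for i
    using run_length_less_bound[OF A bound that] .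
  have gap: "necklace_gap n k A i \<in> {1..n} \<and> offset n i (necklace_gap n k A i) < k"
      "offset n i (necklace_gap n k A i) + 1 = k - run_length n A i" if "i \<in> {1..n}" for i
    using necklace_gap[OF A k that l[OF that]] l[OF that] by auto
  have eq: "(\<forall>i\<in>{1..n}. \<not> arc n i (offset n i (necklace_gap n k A i) + 1) \<subseteq> B) \<longleftrightarrow>
      (\<forall>S\<in>(\<lambda>i. arc n i (k - run_length n A i)) ` ({1..n} - A). \<not> S \<subseteq> B)" (is "?l = ?r") for B
  proof
    assume ?l
    then have "\<not> arc n i (k - run_length n A i) \<subseteq> B" if "i \<in> {1..n}" for i
      using that gap(2)[OF that] by metis
    then show ?r by blast
  next
    assume r: ?r
    show ?l
    proof
      fix i assume i: "i \<in> {1..n}"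
      obtain m where m: "m < n" "forward n i m \<in> {1..n} - A"
        "run_length n A (forward n i m) = run_length n A i + m"
        using next_outside[OF A i] by blast
      have "\<not> arc n (forward n i m) (k - run_length n A (forward n i m)) \<subseteq> B" using r m(2) by blast
      moreover have "k - run_length n A (forward n i m) = k - run_length n A i - m" using m(3) by simp
      moreover have "m \<le> k - run_length n A i" using bound[OF m(2)] m(3) by simp
      ultimately show "\<not> arc n i (offset n i (necklace_gap n k A i) + 1) \<subseteq> B"
        using arc_forward_subset[OF i m(1)] gap(2)[OF i] by (metis subset_trans)
    qed
  qed
  have n: "1 \<le> n" using k by simp
  show ?thesis
    by (simp only: bases_positroid_arc_minus[OF less_imp_le[OF k] n gap(1) I] eq)
qed

lemma elementary_quotient_positroid_runs:
  assumes A: "A \<subset> {1..n}" and k: "1 \<le> k" "k < n"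
    and bound: "\<And>i. i \<in> {1..n} - A \<Longrightarrow> run_length n A i < k"
    and I: "\<And>i. i \<in> {1..n} \<Longrightarrow> grassmann_necklace n s i = arc n i k - {necklace_gap n k A i}"
  shows "elementary_quotient (positroid n s) (uniform_matroid k n) \<longleftrightarrow>
    (\<forall>i\<in>{1..n} - A. \<forall>i'\<in>{1..n} - A. i \<noteq> i' \<longrightarrow> run_length n A i + run_length n A i' < k)"
proof
  have bases: "bases (positroid n s) = {B. B \<subseteq> {1..n} \<and> card B = k - 1 \<and>
      (\<forall>S\<in>(\<lambda>i. arc n i (k - run_length n A i)) ` ({1..n} - A). \<not> S \<subseteq> B)}"
    by (rule bases_positroid_runs[OF A k(2)]) (use bound I in blast)+
  have ground: "ground (positroid n s) = {1..n}" by (simp add: positroid_def Let_def)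
  have card_S: "card (arc n i (k - run_length n A i)) = k - run_length n A i" if "i \<in> {1..n} - A" for i
    using card_arc[of i n] that k by simp
  {
    assume L: "elementary_quotient (positroid n s) (uniform_matroid k n)"
    show "\<forall>i\<in>{1..n} - A. \<forall>i'\<in>{1..n} - A. i \<noteq> i' \<longrightarrow> run_length n A i + run_length n A i' < k"
    proof (intro ballI impI, rule ccontr)
      fix i i' assume i: "i \<in> {1..n} - A" "i' \<in> {1..n} - A" "i \<noteq> i'"
        and "\<not> run_length n A i + run_length n A i' < k"
      then have ge: "k \<le> run_length n A i + run_length n A i'" by simp
      let ?S = "arc n i (k - run_length n A i)" and ?S' = "arc n i' (k - run_length n A i')"
      \<comment> \<open>By \<open>ge\<close> the arc from \<open>i\<close> is no longer than the run
        before \<open>i'\<close>, which does not reach back to \<open>i\<close>; hence the arc ends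
        before \<open>i'\<close>. The same holds with the roles exchanged.\<close>
      have disj: "?S \<inter> ?S' = {}"
        using run_length_separated[OF i] ge i by (intro disjoint_arcs) auto
      have "card (?S \<union> ?S') \<le> k"
        using card_S[OF i(1)] card_S[OF i(2)] ge by (simp add: card_Un_disjoint[OF _ _ disj])
      moreover have "?S \<union> ?S' \<subseteq> {1..n}" using arc_subset by blast
      ultimately obtain K where K: "?S \<union> ?S' \<subseteq> K" "K \<subseteq> {1..n}" "card K = k"
        using exists_subset_between[of "?S \<union> ?S'" k "{1..n}"] k by auto
      obtain B where B: "B \<in> bases (positroid n s)" "B \<subseteq> K"
        using L K unfolding elementary_quotient_uniform_iff[OF k(2) ground] by blast
      have B': "card B = k - 1" "\<not> ?S \<subseteq> B" "\<not> ?S' \<subseteq> B" using B(1) i(1,2) unfolding bases by blast+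
      \<comment> \<open>A basis inside \<open>K\<close> would have to omit a point of each of two
        disjoint sets, but it omits only one point of \<open>K\<close>.\<close>
      obtain x x' where x: "x \<in> ?S" "x \<notin> B" "x' \<in> ?S'" "x' \<notin> B" using B' by blast
      have fK: "finite K" using K(2) by (rule finite_subset) simp
      have "x \<noteq> x'" using x disj by blast
      then have "card {x, x'} = 2" by simp
      moreover have "{x, x'} \<subseteq> K - B" using x K(1) by blast
      ultimately have "2 \<le> card (K - B)" using fK by (metis card_mono finite_Diff)
      moreover have "card (K - B) = k - (k - 1)"
        using B(2) B'(1) K(3) fK by (simp add: card_Diff_subset finite_subset)
      ultimately show False using k by simp
    qed
  next
    assume R: "\<forall>i\<in>{1..n} - A. \<forall>i'\<in>{1..n} - A. i \<noteq> i' \<longrightarrow> run_length n A i + run_length n A i' < k"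
    have "matroid (positroid n s) \<and>
      (\<forall>K. K \<subseteq> {1..n} \<and> card K = k \<longrightarrow> (\<exists>B\<in>bases (positroid n s). B \<subseteq> K))"
    proof (rule forbidden_family_matroid[OF k ground bases])
      show "{} \<notin> (\<lambda>i. arc n i (k - run_length n A i)) ` ({1..n} - A)"
      proof
        assume "{} \<in> (\<lambda>i. arc n i (k - run_length n A i)) ` ({1..n} - A)"
        then obtain i where i: "i \<in> {1..n} - A" "arc n i (k - run_length n A i) = {}" by auto
        then show False using card_S[OF i(1)] bound[OF i(1)] by simp
      qed
      fix S S' K
      assume "S \<in> (\<lambda>i. arc n i (k - run_length n A i)) ` ({1..n} - A)"
        and "S' \<in> (\<lambda>i. arc n i (k - run_length n A i)) ` ({1..n} - A)"
        and ne: "S \<noteq> S'" and sub: "S \<subseteq> K" "S' \<subseteq> K" and K: "K \<subseteq> {1..n}"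
      then obtain i i' where i: "i \<in> {1..n} - A" "i' \<in> {1..n} - A"
        and S: "S = arc n i (k - run_length n A i)" "S' = arc n i' (k - run_length n A i')" by (elim imageE) simp
      have "i \<noteq> i'" using ne S by blast
      then have "k < card (S \<union> S')"
        unfolding S using run_length_separated[OF i] R i k by (intro card_union_arcs) auto
      also have "card (S \<union> S') \<le> card K"
        using sub K by (intro card_mono finite_subset[OF K]) auto
      finally show "card K \<noteq> k" by simp
    qed
    then show "elementary_quotient (positroid n s) (uniform_matroid k n)"
      unfolding elementary_quotient_uniform_iff[OF k(2) ground] using k by (simp add: bases)
  }
qed

section \<open>Recovering the shift from the positroid\<close>

lemma offset_forward_1:
  "i \<in> {1..n} \<Longrightarrow> x \<in> {1..n} \<Longrightarrow> offset n (forward n i 1) x = (if x = i then n - 1 else offset n i x - 1)"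
  by (auto simp: offset_def forward_def)

text \<open>Passing to the next cyclic order only moves \<open>i\<close> from first to last place,
  so membership can change only for \<open>i\<close> and for \<open>p i\<close>, whose preimage is
  \<open>i\<close>.\<close>

lemma grassmann_necklace_step:
  assumes s: "decorated_permutation n (p, col)" and i: "i \<in> {1..n}"
  shows "p i = i \<Longrightarrow>
      grassmann_necklace n (p, col) (forward n i 1) = grassmann_necklace n (p, col) i"
    and "p i = i \<Longrightarrow> i \<in> grassmann_necklace n (p, col) i \<longleftrightarrow> col i = -1"
    and "p i \<noteq> i \<Longrightarrow> i \<in> grassmann_necklace n (p, col) i"
    and "p i \<noteq> i \<Longrightarrow> p i \<notin> grassmann_necklace n (p, col) i"
    and "p i \<noteq> i \<Longrightarrow> grassmann_necklace n (p, col) (forward n i 1) =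
      insert (p i) (grassmann_necklace n (p, col) i - {i})"
proof -
  let ?q = "forward n i 1" and ?I = "grassmann_necklace n (p, col)"
  have perm: "p permutes {1..n}" and col: "\<And>j. j \<in> {1..n} \<Longrightarrow> col j = 0 \<longleftrightarrow> p j \<noteq> j"
    using s unfolding decorated_permutation_def by auto
  have q: "?q \<in> {1..n}" using i by (auto simp: forward_def)
  have inv_mem: "inv p j \<in> {1..n}" if "j \<in> {1..n}" for j
    using that permutes_in_image[OF permutes_inv[OF perm]] by blast
  have inv_eq: "inv p j = m \<longleftrightarrow> p m = j" for j m
    using permutes_inv_eq[OF perm] by metis
  have mem: "j \<in> ?I h \<longleftrightarrow> j \<in> {1..n} \<and> (offset n h j < offset n h (inv p j) \<or> col j = -1)"
    if "h \<in> {1..n}" for h j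
    unfolding grassmann_necklace_def using cyc_less_iff[OF that] inv_mem by auto
  note off = offset_forward_1[OF i]
  have off_pos: "0 < offset n i x" if "x \<in> {1..n}" "x \<noteq> i" for x
    using that i by (auto simp: offset_def)
  have other: "j \<in> ?I ?q \<longleftrightarrow> j \<in> ?I i" if "j \<noteq> i" "p i \<noteq> j" for j
  proof (cases "j \<in> {1..n}")
    case True
    have "inv p j \<noteq> i" using that inv_eq by metis
    then have "offset n ?q j < offset n ?q (inv p j) \<longleftrightarrow> offset n i j < offset n i (inv p j)"
      using off[OF True] off[OF inv_mem[OF True]] off_pos[OF True] off_pos[OF inv_mem[OF True]] that by auto
    then show ?thesis unfolding mem[OF q] mem[OF i] by simp
  next
    case False
    then show ?thesis unfolding mem[OF q] mem[OF i] by blast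
  qed
  show fixI: "i \<in> ?I i \<longleftrightarrow> col i = -1" if "p i = i"
    using that inv_eq[of i i] i by (simp add: mem[OF i])
  have "i \<in> ?I ?q \<longleftrightarrow> col i = -1" if "p i = i"
    using that inv_eq[of i i] i unfolding mem[OF q] by simp
  then show "?I ?q = ?I i" if "p i = i"
    using other fixI that by (intro set_eqI) metis
  assume ne: "p i \<noteq> i"
  have "inv p i \<noteq> i" using ne inv_eq by metis
  then show in_i: "i \<in> ?I i" using off_pos[OF inv_mem[OF i]] i by (simp add: mem[OF i])
  have not_i: "i \<notin> ?I ?q"
    using off[OF i] offset_less[OF q inv_mem[OF i]] col[OF i] ne unfolding mem[OF q] by auto
  have pi: "p i \<in> {1..n}" using permutes_in_image[OF perm] i by blast
  have inv_pi: "inv p (p i) = i" using inv_eq by blast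
  have "p (p i) \<noteq> p i" using ne inv_eq inv_pi by metis
  then have col_pi: "col (p i) = 0" using col[OF pi] by simp
  show "p i \<notin> ?I i" using inv_pi col_pi by (simp add: mem[OF i])
  have "p i \<in> ?I ?q"
    using off[OF i] off[OF pi] offset_less[OF i pi] off_pos[OF pi ne] ne inv_pi pi
    unfolding mem[OF q] by (simp add: diff_less_mono)
  then show "?I ?q = insert (p i) (?I i - {i})"
    using other not_i ne by (intro set_eqI) (metis DiffD1 DiffD2 DiffI insertE insertI1 insertI2 singletonD singletonI)
qed

lemma card_grassmann_necklace:
  assumes s: "decorated_permutation n (p, col)" and i: "i \<in> {1..n}"
  shows "card (grassmann_necklace n (p, col) i) = card (grassmann_necklace n (p, col) 1)"
proof -
  have fin: "finite (grassmann_necklace n (p, col) j)" for j by (simp add: grassmann_necklace_def)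
  have step: "card (grassmann_necklace n (p, col) (forward n j 1)) = card (grassmann_necklace n (p, col) j)"
    if "j \<in> {1..n}" for j
  proof (cases "p j = j")
    case True
    then show ?thesis using grassmann_necklace_step(1)[OF s that] by simp
  next
    case False
    note st = grassmann_necklace_step[OF s that]
    have "card (insert (p j) (grassmann_necklace n (p, col) j - {j})) = Suc (card (grassmann_necklace n (p, col) j - {j}))"
      using st(4)[OF False] fin by (intro card_insert_disjoint) auto
    then show ?thesis using card.remove[OF fin st(3)[OF False]] st(5)[OF False] by simp
  qed
  have "card (grassmann_necklace n (p, col) (Suc d)) = card (grassmann_necklace n (p, col) 1)" if "d < n" for d
    using that
  proof (induction d)
    case (Suc d)
    have "forward n (Suc d) 1 = Suc (Suc d)" using Suc.prems by (simp add: forward_def)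
    then show ?case using step[of "Suc d"] Suc by simp
  qed simp
  moreover have "i - 1 < n" "Suc (i - 1) = i" using i by auto
  ultimately show ?thesis by metis
qed

text \<open>All \<open>r\<close> elements of \<open>B\<close> lie in the initial segment, and
  \<open>I\<close> has at least as many there.\<close>

lemma gale_subset_arc:
  assumes i: "i \<in> {1..n}" and I: "I \<subseteq> {1..n}" "card I = r" and B: "B \<subseteq> arc n i k" "card B = r"
    and gale: "\<forall>t\<in>{1..r}. cyc_le i (cyc_nth i I t) (cyc_nth i B t)"
  shows "I \<subseteq> arc n i k"
proof -
  have "B \<subseteq> {1..n}" using B(1) arc_subset by blast
  then have "card (B \<inter> arc n i k) \<le> card (I \<inter> arc n i k)"
    using gale gale_iff[OF i I _ B(2)] by blast
  then have "card I \<le> card (I \<inter> arc n i k)" using B I(2) by (simp add: inf_absorb1)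
  moreover have "finite I" using I(1) by (rule finite_subset) simp
  ultimately have "I \<inter> arc n i k = I" by (intro card_seteq) auto
  then show ?thesis by blast
qed

lemma arc_forward_1:
  assumes i: "i \<in> {1..n}" and k: "1 \<le> k" "k < n"
  shows "arc n (forward n i 1) k = insert (forward n i k) (arc n i k - {i})"
    and "forward n i k \<notin> arc n i k" and "i \<in> arc n i k"
proof -
  have w: "forward n i k \<in> {1..n}" using forward_mem[OF i k(2)] .
  have off_w: "offset n i (forward n i k) = k" using offset_forward[OF i k(2)] .
  show "forward n i k \<notin> arc n i k" using off_w by (simp add: arc_def)
  show "i \<in> arc n i k" using i k by (simp add: arc_def)
  have pos: "offset n i x \<noteq> 0" if "x \<in> {1..n}" "x \<noteq> i" for x
    using that i by (auto simp: offset_def)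
  have eq_w: "x = forward n i k" if "x \<in> {1..n}" "offset n i x = k" for x
    using that forward_offset[OF i] by metis
  show "arc n (forward n i 1) k = insert (forward n i k) (arc n i k - {i})"
  proof (rule set_eqI)
    fix x
    show "x \<in> arc n (forward n i 1) k \<longleftrightarrow> x \<in> insert (forward n i k) (arc n i k - {i})"
    proof (cases "x \<in> {1..n}")
      case True
      have "x \<in> arc n (forward n i 1) k \<longleftrightarrow> x \<noteq> i \<and> offset n i x < k + 1"
        using True offset_forward_1[OF i True] pos[OF True] k by (auto simp: arc_def)
      moreover have "x \<in> arc n i k \<longleftrightarrow> offset n i x < k" using True by (simp add: arc_def)
      moreover have "x = forward n i k \<longleftrightarrow> offset n i x = k" using eq_w[OF True] off_w by blast
      moreover have "i \<noteq> forward n i k" using off_w k by auto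
      ultimately show ?thesis by auto
    next
      case False
      then show ?thesis using w by (auto simp: arc_def)
    qed
  qed
qed

text \<open>The step from \<open>i\<close> to its successor is read in two ways, as a change of the
  necklace set and as a change of the arc with its gap \<open>x i\<close>. This determines
  \<open>p i\<close>, and \<open>A\<close> collects the steps at which the gap stays.\<close>

lemma necklace_arcs_imp_cyclic_shift:
  assumes s: "decorated_permutation n (p, col)" and k: "1 \<le> k" "k < n"
    and x: "\<And>i. i \<in> {1..n} \<Longrightarrow> x i \<in> arc n i k"
    and I: "\<And>i. i \<in> {1..n} \<Longrightarrow> grassmann_necklace n (p, col) i = arc n i k - {x i}"
  obtains A where "A \<subset> {1..n}" "\<And>i. i \<in> {1..n} \<Longrightarrow> run_length n A i < k"
    "(p, col) = cyclic_shift n A (uniform_perm k n)"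
proof -
  have perm: "p permutes {1..n}"
    and col_cases: "\<And>j. j \<in> {1..n} \<Longrightarrow> col j \<in> {0, 1, -1} \<and> (col j = 0 \<longleftrightarrow> p j \<noteq> j)"
    and col_out: "\<And>j. j \<notin> {1..n} \<Longrightarrow> col j = 0"
    using s unfolding decorated_permutation_def by auto
  define A where "A = {i \<in> {1..n}. x (forward n i 1) = x i}"
  have x_mem: "x i \<in> {1..n}" "offset n i (x i) < k" if "i \<in> {1..n}" for i
    using x[OF that] by (auto simp: arc_def)
  have forward1: "forward n i 1 \<in> {1..n}" if "i \<in> {1..n}" for i
    using that by (auto simp: forward_def)
  \<comment> \<open>The arc trades \<open>i\<close> for the point \<open>k\<close> steps ahead. If
    the gap stays, that point is \<open>p i\<close>; otherwise \<open>p i\<close> fills the old gap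
    and that point becomes the new one. A fixed point leaves the necklace set unchanged, which
    forces \<open>x i = i\<close> and the second alternative.\<close>
  have cases: "i \<in> A \<and> p i = forward n i k \<and> p i \<noteq> i \<or>
      i \<notin> A \<and> p i = x i \<and> x (forward n i 1) = forward n i k \<and> (p i = i \<longrightarrow> col i = 1)"
    if i: "i \<in> {1..n}" for i
  proof -
    let ?q = "forward n i 1" and ?w = "forward n i k"
    note q = forward1[OF i] and arcs = arc_forward_1[OF i k] and st = grassmann_necklace_step[OF s i]
    have A_iff: "i \<in> A \<longleftrightarrow> x ?q = x i" using i by (simp add: A_def)
    have wi: "?w \<noteq> i" using arcs(2,3) by metis
    have wx: "?w \<noteq> x i" using arcs(2) x[OF i] by metis
    have xq: "x ?q = ?w" if "?w \<notin> arc n ?q k - {x ?q}" using that arcs(1) by simp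
    show ?thesis
    proof (cases "p i = i")
      case True
      have eq: "arc n ?q k - {x ?q} = arc n i k - {x i}" using st(1)[OF True] I[OF i] I[OF q] by simp
      have "x ?q = ?w" using xq arcs(2) unfolding eq by simp
      moreover have "i \<notin> arc n i k - {x i}" unfolding eq[symmetric] arcs(1) using wi by simp
      then have "x i = i" "i \<notin> grassmann_necklace n (p, col) i" using arcs(3) I[OF i] by auto
      moreover have "col i = 1"
        using st(2)[OF True] \<open>i \<notin> grassmann_necklace n (p, col) i\<close> col_cases[OF i] True by auto
      ultimately show ?thesis using True wx A_iff by metis
    next
      case False
      have eq: "arc n ?q k - {x ?q} = insert (p i) (arc n i k - {x i} - {i})"
        using st(5)[OF False] I[OF i] I[OF q] by simp
      have pi: "p i \<notin> arc n i k - {x i}" using st(4)[OF False] I[OF i] by simp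
      have xi: "x i \<noteq> i" using st(3)[OF False] I[OF i] by auto
      show ?thesis
      proof (cases "x ?q = x i")
        case True
        then have "?w \<in> arc n ?q k - {x ?q}" using arcs(1) wx by simp
        then have "p i = ?w" unfolding eq using arcs(2) by simp
        then show ?thesis using True A_iff False by simp
      next
        case neq: False
        have "x i \<in> arc n ?q k - {x ?q}" using arcs(1) x[OF i] xi neq by simp
        then have "p i = x i" unfolding eq by simp
        moreover have "?w \<notin> arc n ?q k - {x ?q}"
          unfolding eq using arcs(2) wx \<open>p i = x i\<close> by simp
        then have "x ?q = ?w" by (rule xq)
        ultimately show ?thesis using neq A_iff False by simp
      qed
    qed
  qed
  have A: "A \<subset> {1..n}"
  proof -
    \<comment> \<open>Otherwise the gap is constant. But the arc of length \<open>k < n\<close>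
      starting just after this point does not contain it.\<close>
    have "A \<noteq> {1..n}"
    proof
      assume eq: "A = {1..n}"
      have const: "x (Suc d) = x 1" if "d < n" for d
        using that
      proof (induction d)
        case (Suc d)
        have "forward n (Suc d) 1 = Suc (Suc d)" using Suc.prems by (simp add: forward_def)
        moreover have "Suc d \<in> A" using Suc.prems eq by simp
        ultimately show ?case using Suc by (simp add: A_def)
      qed simp
      have const': "x i = x 1" if "i \<in> {1..n}" for i
        using const[of "i - 1"] that by (cases i) auto
      have one: "x 1 \<in> {1..n}" using x_mem(1)[of 1] k by simp
      have "offset n (forward n (x 1) 1) (x 1) = n - 1" using offset_forward_1[OF one one] by simp
      moreover have "offset n (forward n (x 1) 1) (x 1) < k"
        using x_mem(2)[OF forward1[OF one]] const'[OF forward1[OF one]] by simp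
      ultimately show False using k by simp
    qed
    then show ?thesis unfolding A_def by blast
  qed
  have x_eq: "x i = forward n (backward n i (run_length n A i)) k" if i: "i \<in> {1..n}" for i
  proof -
    \<comment> \<open>\<open>g d\<close> is the successor of \<open>backward n i d\<close>. Going
      back through the run keeps the gap, down to the step at a point outside \<open>A\<close> that
      created it.\<close>
    define g where "g = (\<lambda>d. if d = 0 then i else backward n i (d - 1))"
    have Ln: "run_length n A i < n" using run_length_less[OF A i] .
    have g: "forward n (backward n i d) 1 = g d" if "d < n" for d
      using i that unfolding g_def by (auto simp: forward_def backward_def)
    have "x (g d) = x i" if "d \<le> run_length n A i" for d
      using that
    proof (induction d)
      case 0
      then show ?case by (simp add: g_def)
    next
      case (Suc d)
      have "backward n i d \<in> A" using Suc.prems by (intro backward_in) simp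
      then have "x (g d) = x (backward n i d)" using g[of d] Suc.prems Ln by (simp add: A_def)
      then show ?case using Suc by (simp add: g_def)
    qed
    then have "x i = x (forward n (backward n i (run_length n A i)) 1)" using g[OF Ln] by simp
    also have "\<dots> = forward n (backward n i (run_length n A i)) k"
      using cases[of "backward n i (run_length n A i)"] backward_run_length[OF A i] by blast
    finally show ?thesis .
  qed
  \<comment> \<open>If the run had length \<open>l >= k\<close>, the formula for the gap would give
    the offset \<open>n - 1 - l + k\<close>, at least \<open>k\<close>, outside the arc.\<close>
  have "run_length n A i < k" if i: "i \<in> {1..n}" for i
  proof -
    have "backward n i (run_length n A i) \<in> {1..n}" using backward_run_length[OF A i] by blast
    from offset_forward'[OF i this k(2)]
    show ?thesis
      using x_mem(2)[OF i] offset_backward[OF i run_length_less[OF A i]] run_length_less[OF A i] k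
      unfolding x_eq[OF i] by (simp split: if_splits)
  qed
  moreover have "(p, col) = cyclic_shift n A (uniform_perm k n)"
  proof -
    define u where "u = fst (uniform_perm k n)"
    have u: "uniform_perm k n = (u, \<lambda>i. 0)" by (simp add: u_def uniform_perm_def)
    have u_forward: "u i = forward n i k" if "i \<in> {1..n}" for i
      unfolding u_def by (rule uniform_perm_forward[OF k(2) that])
    have p: "p i = (if i \<in> {1..n} - A then u (cyc_max i ({1..n} - A)) else u i)" for i
    proof (cases "i \<in> {1..n}")
      case i: True
      show ?thesis
      proof (cases "i \<in> A")
        case True
        then show ?thesis using cases[OF i] u_forward[OF i] by simp
      next
        case False
        have "cyc_max i ({1..n} - A) \<in> {1..n}"
          unfolding cyc_max_complement[OF A i] using backward_run_length[OF A i] by blast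
        then have "u (cyc_max i ({1..n} - A)) = x i"
          using u_forward x_eq[OF i] cyc_max_complement[OF A i] by simp
        then show ?thesis using False cases[OF i] i by simp
      qed
    next
      case False
      then have "p i = i" using permutes_not_in[OF perm] by blast
      moreover have "u i = i" by (simp only: u_def uniform_perm_def fst_conv False if_False)
      ultimately show ?thesis using False by (simp only: Diff_iff simp_thms if_False)
    qed
    have c: "col i = (if i \<in> {1..n} - A then (if p i = i then 1 else 0) else 0)" for i
    proof (cases "i \<in> {1..n}")
      case True
      then show ?thesis using cases[OF True] col_cases[OF True] by auto
    next
      case False
      then show ?thesis using col_out by auto
    qed
    have "cyclic_shift n A (uniform_perm k n) =
        (p, \<lambda>i. if i \<in> {1..n} - A then (if p i = i then 1 else 0) else 0)"
      by (simp only: u cyclic_shift_def Let_def prod.case p[symmetric])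
    then show ?thesis using c by (simp add: fun_eq_iff)
  qed
  ultimately show thesis using that A by blast
qed

lemma elementary_quotient_imp_cyclic_shift:
  assumes k: "1 \<le> k" "k < n" and s: "decorated_permutation n s"
    and quot: "elementary_quotient (positroid n s) (uniform_matroid k n)"
  obtains A where "A \<subset> {1..n}" "\<And>i. i \<in> {1..n} \<Longrightarrow> run_length n A i < k"
    "s = cyclic_shift n A (uniform_perm k n)"
proof -
  obtain p col where pc: "s = (p, col)" by fastforce
  let ?I = "grassmann_necklace n s"
  have bases: "bases (positroid n s) = {B. B \<subseteq> {1..n} \<and> card B = card (?I 1) \<and>
      (\<forall>i\<in>{1..n}. \<forall>t\<in>{1..card (?I 1)}. cyc_le i (cyc_nth i (?I i) t) (cyc_nth i B t))}"
    and ground: "ground (positroid n s) = {1..n}"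
    by (simp_all add: positroid_def Let_def)
  have mat: "matroid (positroid n s)" and card: "\<And>B. B \<in> bases (positroid n s) \<Longrightarrow> card B + 1 = k"
    and contains: "\<And>K. K \<subseteq> {1..n} \<Longrightarrow> card K = k \<Longrightarrow> \<exists>B\<in>bases (positroid n s). B \<subseteq> K"
    using quot unfolding elementary_quotient_uniform_iff[OF k(2) ground] by blast+
  obtain B0 where B0: "B0 \<in> bases (positroid n s)" using mat unfolding matroid_def by blast
  have "card B0 = card (?I 1)" using B0 unfolding bases by simp
  then have r: "card (?I 1) + 1 = k" using card[OF B0] by simp
  \<comment> \<open>The arc is a \<open>k\<close>-set and so contains a basis. The necklace set
    precedes this basis in the Gale order, hence lies in the arc too, and with \<open>k - 1\<close>
    elements it omits exactly one point.\<close>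
  have "\<exists>x. x \<in> arc n i k \<and> ?I i = arc n i k - {x}" if i: "i \<in> {1..n}" for i
  proof -
    have card_arc: "card (arc n i k) = k" using card_arc[OF i] k by simp
    have card_I: "card (?I i) = card (?I 1)" using card_grassmann_necklace s i unfolding pc by blast
    obtain B where B: "B \<in> bases (positroid n s)" "B \<subseteq> arc n i k"
      using contains[OF arc_subset card_arc] by blast
    have "?I i \<subseteq> {1..n}" unfolding grassmann_necklace_def by (auto simp: case_prod_beta)
    moreover have "card B = card (?I 1)"
      "\<forall>t\<in>{1..card (?I 1)}. cyc_le i (cyc_nth i (?I i) t) (cyc_nth i B t)"
      using B(1) i unfolding bases by simp_all
    ultimately have sub: "?I i \<subseteq> arc n i k" using gale_subset_arc[OF i _ card_I B(2)] by blast
    have "card (arc n i k - ?I i) = k - card (?I i)"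
      using card_arc sub by (simp add: card_Diff_subset finite_subset[OF sub])
    then have "card (arc n i k - ?I i) = 1" using card_I r by simp
    then obtain x where "arc n i k - ?I i = {x}" by (rule card_1_singletonE)
    then have "x \<in> arc n i k" "?I i = arc n i k - {x}" using sub by blast+
    then show ?thesis by blast
  qed
  then obtain x where "\<And>i. i \<in> {1..n} \<Longrightarrow> x i \<in> arc n i k \<and> ?I i = arc n i k - {x i}" by metis
  then show thesis
    using necklace_arcs_imp_cyclic_shift[of n p col k x] s k that unfolding pc by blast
qed

theorem theorem4p18:
  fixes n k :: nat and s :: decorated_perm
  assumes "1 \<le> k" and "k \<le> n - 1"
    and "decorated_permutation n s"
  shows "elementary_quotient (positroid n s) (uniform_matroid k n) \<longleftrightarrow>
    (\<exists>A. A \<subset> {1..n} \<and> component_unions_bounded n A (k - 1) \<and>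
         s = cyclic_shift n A (uniform_perm k n))"
proof -
  have k: "1 \<le> k" "k < n" using assms by auto
  \<comment> \<open>The necklace computation requires all runs to be shorter than \<open>k\<close>;
    each direction supplies this bound before using the equivalence.\<close>
  have main: "elementary_quotient (positroid n s) (uniform_matroid k n) \<longleftrightarrow>
      component_unions_bounded n A (k - 1)"
    if A: "A \<subset> {1..n}" and bound: "\<And>i. i \<in> {1..n} - A \<Longrightarrow> run_length n A i < k"
      and s: "s = cyclic_shift n A (uniform_perm k n)" for A
  proof -
    have "grassmann_necklace n s i = arc n i k - {necklace_gap n k A i}" if "i \<in> {1..n}" for i
      using grassmann_necklace_cyclic_shift[OF A k(2) bound assms(3)[unfolded s] that] s by simp
    then have "elementary_quotient (positroid n s) (uniform_matroid k n) \<longleftrightarrow>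
      (\<forall>i\<in>{1..n} - A. \<forall>i'\<in>{1..n} - A. i \<noteq> i' \<longrightarrow> run_length n A i + run_length n A i' < k)"
      by (intro elementary_quotient_positroid_runs[OF A k bound])
    moreover have "c \<le> k - 1 \<longleftrightarrow> c < k" for c using k by auto
    ultimately show ?thesis
      unfolding component_unions_bounded_iff[OF A] using bound by simp
  qed
  show ?thesis
  proof
    assume L: "elementary_quotient (positroid n s) (uniform_matroid k n)"
    obtain A where A: "A \<subset> {1..n}" "\<And>i. i \<in> {1..n} \<Longrightarrow> run_length n A i < k"
      "s = cyclic_shift n A (uniform_perm k n)"
      using elementary_quotient_imp_cyclic_shift[OF k assms(3) L] by blast
    have "component_unions_bounded n A (k - 1)" using main[OF A(1) A(2) A(3)] L by blast
    then show "\<exists>A. A \<subset> {1..n} \<and> component_unions_bounded n A (k - 1) \<and>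
         s = cyclic_shift n A (uniform_perm k n)" using A(1,3) by blast
  next
    assume "\<exists>A. A \<subset> {1..n} \<and> component_unions_bounded n A (k - 1) \<and>
         s = cyclic_shift n A (uniform_perm k n)"
    then obtain A where A: "A \<subset> {1..n}" "component_unions_bounded n A (k - 1)"
      "s = cyclic_shift n A (uniform_perm k n)" by blast
    have "run_length n A i < k" if "i \<in> {1..n} - A" for i
    proof -
      \<comment> \<open>This uses the case of coinciding components, which also bounds a sole
        component.\<close>
      have "run_length n A i \<le> k - 1"
        using A(2) that unfolding component_unions_bounded_iff[OF A(1)] by blast
      then show ?thesis using k by linarith
    qed
    from main[OF A(1) this A(3)] A(2)
    show "elementary_quotient (positroid n s) (uniform_matroid k n)" by blast
  qed
qed

end
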